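(* For every poset ideal $P$ of $D$ with $P\subseteq D_{\mathcal V}$, the complex $\tilde{\mathcal K}_P\otimes_T S$ is a minimal $S$-free resolution of $S/J_P$.
   Context: $K$ is an infinite field, $V$ a $K$-vector space of finite dimension, and $S=\mathrm{Sym}_K(V)$, a polynomial ring with the standard grading. $\mathcal V=V_1,\dots,V_n$ is a subspace arrangement, i.e. a finite collection of non-zero $K$-subspaces of $V$ (inclusions and equalities allowed); $d_i=\dim_K V_i$. $\mathbb N$ contains $0$ and $[u]=\{1,\dots,u\}$. A collection of bases of $\mathcal V$ is a family $\{f_{ij}: i\in[n], j\in[d_i]\}$ such that for each $i$, $f_{i1},\dots,f_{id_i}$ is an ordered $K$-basis of $V_i$. For $a\in\mathbb N^n$ with $a_i\le d_i$ for all $i$, put $W_a=\langle f_{ij}: i\in[n],\ j\in[a_i]\rangle\subseteq V$. We fix a collection of bases satisfying the following genericity assumption: for all $a\in\mathbb N^n$ with $a_i\le d_i$, the dimension of $W_a$ is the largest possible among all collections of bases of $\mathcal V$. $D=[d_1]\times\cdots\times[d_n]$ with the componentwise partial order. A poset ideal of $D$ is a subset $P\subseteq D$ such that $a\in D$, $b\in P$, $a\le b$ imply $a\in P$. For $a\in D$ put $f_a=\prod_{i=1}^n f_{ia_i}\in S$, and $J_P=(f_a:a\in P)\subseteq S$. For $A\subseteq[n]$ let $\operatorname{rk}_{\mathcal V}(A)=\dim_K\sum_{i\in A}V_i$, and set $D_{\mathcal V}=\{a\in D: \sum_{i\in T}a_i-|T|\le\operatorname{rk}_{\mathcal V}(T)-1\text{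 for every }\emptyset\ne T\subseteq[n]\}$. Let $T=K[x_{ij}: i\in[n], j\in[d_i]]$, and regard $S$ as a $T$-module via the $K$-algebra map $T\to S$, $x_{ij}\mapsto f_{ij}$. The complex $\tilde{\mathcal K}_P$ of free $T$-modules is defined as follows. For $i\in[n]$ let $e_{i1},\dots,e_{id_i}$ be the canonical basis of $T^{d_i}$, and for non-empty $A_i=\{j_1<j_2<\cdots\}\subseteq[d_i]$ let $e_{A_i}=e_{ij_1}\wedge e_{ij_2}\wedge\cdots$. For $A=(A_1,\dots,A_n)$ with each $A_i\subseteq[d_i]$ non-empty let $e_A=e_{A_1}\otimes\cdots\otimes e_{A_n}$, placed in homological degree $\sum_{i=1}^n|A_i|-n$. The complex $\mathcal K_P$ is the free $T$-module with basis all $e_A$ such that $(\max A_1,\dots,\max A_n)\in P$, with differential $$\partial(e_A)=\sum_{i\in[n],\,|A_i|>1}\ \sum_{b\in A_i}(-1)^{\sigma(i,b)}x_{ib}\ e_{A_1}\otimes\cdots\otimes e_{A_i\setminus\{b\}}\otimes\cdots\otimes e_{A_n},$$ $$\sigma(i,b)=\sum_{j<i}(|A_j|-1)+|\{c\in A_i: c<b\}|.$$ (It is a subcomplex of the tensor product over $i$ of the Koszul complexes on $x_{i1},\dots,x_{id_i}$ with the $0$-th component removed and homologically shifted by one.) Finally $\tilde{\mathcal K}_P$ is obtained by augmenting $\mathcal K_P$ with the map $(\mathcal K_P)_0\to T$ sending $e_{1a_1}\otimes\cdots\otimes e_{na_n}$ to $x_{1a_1}\cdots x_{na_n}$ for $a\in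 P$, with $T$ placed in homological degree $0$ and $(\mathcal K_P)_j$ in degree $j+1$. *)

theory Defs
  imports Complex_Main "HOL-Library.Cardinality" "HOL-Library.Poly_Mapping" "HOL-Library.Set_Algebras"
begin

text \<open>The polynomial ring over \<open>'k\<close> in variables indexed by \<open>'x\<close>: finitely supported functions from
  exponent vectors to coefficients, with the convolution product of \<^theory>\<open>HOL-Library.Poly_Mapping\<close>.\<close>

type_synonym ('x, 'k) mpoly = "('x \<Rightarrow>\<^sub>0 nat) \<Rightarrow>\<^sub>0 'k"

definition const :: "'k \<Rightarrow> ('x, 'k::comm_ring_1) mpoly" where
  "const c = Poly_Mapping.single 0 c"

definition var :: "'x \<Rightarrow> ('x, 'k::comm_ring_1) mpoly" where
  "var x = Poly_Mapping.single (Poly_Mapping.single x 1) 1"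

definition mdeg :: "('x \<Rightarrow>\<^sub>0 nat) \<Rightarrow> nat" where
  "mdeg m = (\<Sum>x\<in>Poly_Mapping.keys m. Poly_Mapping.lookup m x)"

definition homogeneous :: "nat \<Rightarrow> ('x, 'k::comm_ring_1) mpoly \<Rightarrow> bool" where
  "homogeneous d p \<longleftrightarrow> (\<forall>m\<in>Poly_Mapping.keys p. mdeg m = d)"

definition irrelevant_ideal :: "('x, 'k::comm_ring_1) mpoly set" where
  "irrelevant_ideal = {p. \<forall>m\<in>Poly_Mapping.keys p. 0 < mdeg m}"

text \<open>The \<open>'k\<close>-algebra homomorphism between polynomial rings that sends each variable \<open>x\<close> to \<open>g x\<close>.\<close>

definition subst_hom :: "('x \<Rightarrow> ('y, 'k) mpoly) \<Rightarrow> ('x, 'k::comm_ring_1) mpoly \<Rightarrow> ('y, 'k) mpoly" where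
  "subst_hom g p = (\<Sum>m\<in>Poly_Mapping.keys p.
     const (Poly_Mapping.lookup p m)
       * (\<Prod>x\<in>Poly_Mapping.keys m. g x ^ Poly_Mapping.lookup m x))"

text \<open>The ideal generated by \<open>G\<close>, as the submodule of the ring (a module over itself) spanned by \<open>G\<close>.\<close>

definition ideal_gen :: "'r::comm_ring_1 set \<Rightarrow> 'r set" where
  "ideal_gen G = module.span (*) G"

text \<open>The free \<open>'r\<close>-module with basis \<open>E\<close> is the set of finitely supported functions
  \<open>'e \<Rightarrow>\<^sub>0 'r\<close> with support in \<open>E\<close>; the basis element \<open>e\<close> is \<open>Poly_Mapping.single e 1\<close>.\<close>

definition free_mod :: "'e set \<Rightarrow> ('e \<Rightarrow>\<^sub>0 'r::comm_ring_1) set" where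
  "free_mod E = {v. Poly_Mapping.keys v \<subseteq> E}"

definition smult :: "'r::comm_ring_1 \<Rightarrow> ('e \<Rightarrow>\<^sub>0 'r) \<Rightarrow> ('e \<Rightarrow>\<^sub>0 'r)" where
  "smult r v = Poly_Mapping.map ((*) r) v"

definition lin_ext :: "('e \<Rightarrow> ('e' \<Rightarrow>\<^sub>0 'r)) \<Rightarrow> ('e \<Rightarrow>\<^sub>0 'r::comm_ring_1) \<Rightarrow> ('e' \<Rightarrow>\<^sub>0 'r)" where
  "lin_ext g v = (\<Sum>e\<in>Poly_Mapping.keys v. smult (Poly_Mapping.lookup v e) (g e))"

text \<open>\<open>gens F k\<close> is the basis of the module in homological degree \<open>k\<close> (the bases in
  different degrees are meant to be disjoint), and \<open>bd F e\<close> is the differential of the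
  basis element \<open>e\<close>. Values of \<open>bd F\<close> on the generators of degree \<open>0\<close> are irrelevant.\<close>

record (overloaded) ('e, 'r) free_complex =
  gens :: "nat \<Rightarrow> 'e set"
  bd :: "'e \<Rightarrow> ('e \<Rightarrow>\<^sub>0 'r)"

definition chain_mod :: "('e, 'r::comm_ring_1) free_complex \<Rightarrow> nat \<Rightarrow> ('e \<Rightarrow>\<^sub>0 'r) set" where
  "chain_mod F k = free_mod (gens F k)"

text \<open>The extension of scalars along a ring homomorphism \<open>\<phi>\<close> of a complex of free modules: the free
  modules on the same bases, with \<open>\<phi>\<close> applied to all matrix entries of the differentials.\<close>

definition base_change ::
  "('r::comm_ring_1 \<Rightarrow> 's::comm_ring_1) \<Rightarrow> ('e, 'r) free_complex \<Rightarrow> ('e, 's) free_complex" where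
  "base_change \<phi> F = \<lparr>gens = gens F, bd = (\<lambda>e. Poly_Mapping.map \<phi> (bd F e))\<rparr>"

text \<open>Surjective \<open>'r\<close>-linear maps \<open>\<epsilon>\<close> from the free module on \<open>E\<close> to the quotient module \<open>'r/J\<close>. The
  elements of the latter are the cosets \<open>r +o J\<close>; they are added as sets, the zero element is \<open>J\<close>,
  and \<open>r\<close> acts on a coset \<open>C\<close> by \<open>r *o C + J\<close>.\<close>

definition augmentation :: "'e set \<Rightarrow> 'r::comm_ring_1 set \<Rightarrow> (('e \<Rightarrow>\<^sub>0 'r) \<Rightarrow> 'r set) \<Rightarrow> bool" where
  "augmentation E J \<epsilon> \<longleftrightarrow>
     \<epsilon> ` free_mod E = {r +o J |r. True} \<and>
     (\<forall>u\<in>free_mod E. \<forall>v\<in>free_mod E. \<epsilon> (u + v) = \<epsilon> u + \<epsilon> v) \<and>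
     (\<forall>r. \<forall>v\<in>free_mod E. \<epsilon> (smult r v) = r *o \<epsilon> v + J)"

text \<open>Exactness of \<open>\<dots> \<rightarrow> F\<^sub>2 \<rightarrow> F\<^sub>1 \<rightarrow> F\<^sub>0 \<rightarrow> 'r/J \<rightarrow> 0\<close>, all \<open>F\<^sub>k\<close> being free of finite rank.\<close>

definition free_resolution ::
  "('e, 'r::comm_ring_1) free_complex \<Rightarrow> 'r set \<Rightarrow> (('e \<Rightarrow>\<^sub>0 'r) \<Rightarrow> 'r set) \<Rightarrow> bool" where
  "free_resolution F J \<epsilon> \<longleftrightarrow>
     (\<forall>k. finite (gens F k)) \<and>
     (\<forall>k. \<forall>e\<in>gens F (Suc k). bd F e \<in> chain_mod F k) \<and>
     augmentation (gens F 0) J \<epsilon> \<and>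
     {v \<in> chain_mod F 0. \<epsilon> v = J} = lin_ext (bd F) ` chain_mod F 1 \<and>
     (\<forall>k. {v \<in> chain_mod F (Suc k). lin_ext (bd F) v = 0}
            = lin_ext (bd F) ` chain_mod F (Suc (Suc k)))"

text \<open>If the basis elements \<open>e\<close> are given the internal degrees \<open>\<delta> e\<close>, then the differentials and
  the augmentation are homogeneous of degree \<open>0\<close>.\<close>

definition graded_with ::
  "('e, ('x, 'k::comm_ring_1) mpoly) free_complex \<Rightarrow> ('x, 'k) mpoly set
     \<Rightarrow> (('e \<Rightarrow>\<^sub>0 ('x, 'k) mpoly) \<Rightarrow> ('x, 'k) mpoly set) \<Rightarrow> ('e \<Rightarrow> nat) \<Rightarrow> bool" where
  "graded_with F J \<epsilon> \<delta> \<longleftrightarrow>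
     (\<forall>k. \<forall>e\<in>gens F (Suc k). \<forall>e'\<in>Poly_Mapping.keys (bd F e).
        \<delta> e' \<le> \<delta> e \<and> homogeneous (\<delta> e - \<delta> e') (Poly_Mapping.lookup (bd F e) e')) \<and>
     (\<forall>e\<in>gens F 0. \<exists>p. homogeneous (\<delta> e) p \<and> \<epsilon> (Poly_Mapping.single e 1) = p +o J)"

definition minimal_complex :: "('e, ('x, 'k::comm_ring_1) mpoly) free_complex \<Rightarrow> bool" where
  "minimal_complex F \<longleftrightarrow>
     (\<forall>k. \<forall>e\<in>gens F (Suc k). \<forall>e'. Poly_Mapping.lookup (bd F e) e' \<in> irrelevant_ideal)"

definition minimal_free_resolution_of_quotient ::
  "('e, ('x, 'k::comm_ring_1) mpoly) free_complex \<Rightarrow> ('x, 'k) mpoly set \<Rightarrow> bool" where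
  "minimal_free_resolution_of_quotient F J \<longleftrightarrow>
     (\<exists>\<epsilon> \<delta>. free_resolution F J \<epsilon> \<and> graded_with F J \<epsilon> \<delta>) \<and> minimal_complex F"

text \<open>The index set \<open>{1,\<dots>,n}\<close> of an arrangement is a finite linearly ordered type \<open>'n\<close>, so
  \<open>n = CARD('n) \<ge> 1\<close>, and elements of \<open>\<nat>\<^sup>n\<close> are functions \<open>'n \<Rightarrow> nat\<close> with the pointwise order.\<close>

definition subspace_arrangement ::
  "('k::field \<Rightarrow> 'v::ab_group_add \<Rightarrow> 'v) \<Rightarrow> ('n::finite \<Rightarrow> 'v set) \<Rightarrow> bool" where
  "subspace_arrangement scale V \<longleftrightarrow> (\<forall>i. module.subspace scale (V i) \<and> V i \<noteq> {0})"

definition bases_collection ::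
  "('k::field \<Rightarrow> 'v::ab_group_add \<Rightarrow> 'v) \<Rightarrow> ('n::finite \<Rightarrow> 'v set) \<Rightarrow> ('n \<Rightarrow> nat \<Rightarrow> 'v) \<Rightarrow> bool" where
  "bases_collection scale V f \<longleftrightarrow>
     (\<forall>i. inj_on (f i) {1..vector_space.dim scale (V i)} \<and>
          \<not> module.dependent scale (f i ` {1..vector_space.dim scale (V i)}) \<and>
          module.span scale (f i ` {1..vector_space.dim scale (V i)}) = V i)"

definition W_space ::
  "('k::field \<Rightarrow> 'v::ab_group_add \<Rightarrow> 'v) \<Rightarrow> ('n::finite \<Rightarrow> nat \<Rightarrow> 'v) \<Rightarrow> ('n \<Rightarrow> nat) \<Rightarrow> 'v set" where
  "W_space scale f a = module.span scale {f i j |i j. j \<in> {1..a i}}"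

definition generic_bases ::
  "('k::field \<Rightarrow> 'v::ab_group_add \<Rightarrow> 'v) \<Rightarrow> ('n::finite \<Rightarrow> 'v set) \<Rightarrow> ('n \<Rightarrow> nat \<Rightarrow> 'v) \<Rightarrow> bool" where
  "generic_bases scale V f \<longleftrightarrow>
     bases_collection scale V f \<and>
     (\<forall>a. (\<forall>i. a i \<le> vector_space.dim scale (V i)) \<longrightarrow>
        (\<forall>g. bases_collection scale V g \<longrightarrow>
           vector_space.dim scale (W_space scale g a) \<le> vector_space.dim scale (W_space scale f a)))"

definition D_box :: "('n::finite \<Rightarrow> nat) \<Rightarrow> ('n \<Rightarrow> nat) set" where
  "D_box d = {a. \<forall>i. a i \<in> {1..d i}}"

definition poset_ideal :: "('n::finite \<Rightarrow> nat) \<Rightarrow> ('n \<Rightarrow> nat) set \<Rightarrow> bool" where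
  "poset_ideal d P \<longleftrightarrow> P \<subseteq> D_box d \<and> (\<forall>a\<in>D_box d. \<forall>b\<in>P. a \<le> b \<longrightarrow> a \<in> P)"

text \<open>The sum of the subspaces \<open>V i\<close>, \<open>i \<in> A\<close>, is the span of their union.\<close>

definition arr_rank ::
  "('k::field \<Rightarrow> 'v::ab_group_add \<Rightarrow> 'v) \<Rightarrow> ('n::finite \<Rightarrow> 'v set) \<Rightarrow> 'n set \<Rightarrow> nat" where
  "arr_rank scale V A = vector_space.dim scale (module.span scale (\<Union>i\<in>A. V i))"

definition D_arr ::
  "('k::field \<Rightarrow> 'v::ab_group_add \<Rightarrow> 'v) \<Rightarrow> ('n::finite \<Rightarrow> 'v set) \<Rightarrow> ('n \<Rightarrow> nat) set" where
  "D_arr scale V =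
     {a \<in> D_box (\<lambda>i. vector_space.dim scale (V i)).
        \<forall>T. T \<noteq> {} \<longrightarrow> (\<Sum>i\<in>T. int (a i)) - int (card T) \<le> int (arr_rank scale V T) - 1}"

text \<open>For a vector space with basis \<open>x\<close>, indexed by the finite type \<open>'b\<close>, the symmetric algebra is
  the polynomial ring \<open>('b, 'k) mpoly\<close>, whose variable \<open>b\<close> is the basis vector \<open>x b\<close>; this is the
  embedding of the vector space as the space of linear forms.\<close>

definition lin_form ::
  "('k::field \<Rightarrow> 'v::ab_group_add \<Rightarrow> 'v) \<Rightarrow> ('b::finite \<Rightarrow> 'v) \<Rightarrow> 'v \<Rightarrow> ('b, 'k) mpoly" where
  "lin_form scale x v = (\<Sum>b\<in>UNIV. const (module.representation scale (range x) v (x b)) * var b)"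

definition J_ideal :: "('n::finite \<Rightarrow> nat \<Rightarrow> ('b, 'k::field) mpoly) \<Rightarrow> ('n \<Rightarrow> nat) set \<Rightarrow> ('b, 'k) mpoly set" where
  "J_ideal f P = ideal_gen ((\<lambda>a. \<Prod>i\<in>UNIV. f i (a i)) ` P)"

text \<open>\<open>Aug\<close> is the basis element of the ring in homological degree \<open>0\<close>, and \<open>Kos A\<close> is the basis
  element \<open>e\<^sub>A\<close>. The variable \<open>x\<^sub>i\<^sub>j\<close> is \<open>var (i, j)\<close>; only those with \<open>1 \<le> j \<le> d i\<close> occur,
  and the presence of further variables in the coefficient ring does not affect base changes.\<close>

datatype 'n gen = Aug | Kos "'n \<Rightarrow> nat set"

definition sigma_sign :: "('n::{finite,linorder} \<Rightarrow> nat set) \<Rightarrow> 'n \<Rightarrow> nat \<Rightarrow> nat" where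
  "sigma_sign A i b = (\<Sum>j\<in>{..<i}. card (A j) - 1) + card {c \<in> A i. c < b}"

definition koszul_bd ::
  "('n::{finite,linorder} \<Rightarrow> nat set) \<Rightarrow> ('n gen \<Rightarrow>\<^sub>0 ('n \<times> nat, 'k::field) mpoly)" where
  "koszul_bd A = (\<Sum>i\<in>{i. card (A i) > 1}. \<Sum>b\<in>A i.
     Poly_Mapping.single (Kos (A(i := A i - {b}))) ((-1) ^ sigma_sign A i b * var (i, b)))"

text \<open>If all \<open>A i\<close> are singletons, \<open>{a\<^sub>i}\<close> say, then \<open>e\<^sub>A\<close> spans degree \<open>1\<close> and maps to the product of the
  \<open>var (i, a\<^sub>i)\<close>; otherwise the boundary is that of the tensor product of truncated Koszul complexes.
  A generator with \<open>\<Sum>\<^sub>i |A\<^sub>i| - n = k\<close> is placed in degree \<open>k + 1\<close>.\<close>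

definition K_tilde ::
  "('n::{finite,linorder} \<Rightarrow> nat) \<Rightarrow> ('n \<Rightarrow> nat) set
     \<Rightarrow> ('n gen, ('n \<times> nat, 'k::field) mpoly) free_complex" where
  "K_tilde d P =
     \<lparr>gens = (\<lambda>k. case k of
          0 \<Rightarrow> {Aug}
        | Suc k \<Rightarrow> {Kos A |A. (\<forall>i. A i \<noteq> {} \<and> A i \<subseteq> {1..d i}) \<and> (\<lambda>i. Max (A i)) \<in> P \<and>
                            (\<Sum>i\<in>UNIV. card (A i)) = k + CARD('n)}),
      bd = (\<lambda>e. case e of
          Aug \<Rightarrow> 0
        | Kos A \<Rightarrow>
            if \<forall>i. card (A i) = 1
            then Poly_Mapping.single Aug (\<Prod>i\<in>UNIV. var (i, the_elem (A i)))
            else koszul_bd A)\<rparr>"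

end

theory Submission
  imports Defs "HOL-Library.Product_Lexorder"
begin

text \<open>Write \<open>f\<^sub>i\<^sub>j\<close> for the linear forms of the chosen bases and \<open>f\<^sub>a\<close> for the product of the \<open>f i (a i)\<close>.
The complex is built up by adding one element of \<open>P\<close> at a time.
Let \<open>a\<close> be maximal in \<open>P\<close> and \<open>P' = P - {a}\<close>. The basis elements \<open>e\<^sub>A\<close> of the complex of \<open>P\<close> that are
not in the subcomplex of \<open>P'\<close> are those with \<open>max A\<^sub>i = a i\<close> for all \<open>i\<close>. Removing the points
\<open>(i, a i)\<close> from such an \<open>A\<close> leaves an arbitrary subset of \<open>below a = {(i, j). 1 \<le> j < a i}\<close>, so the quotient of the two
complexes is the Koszul complex on the \<open>f\<^sub>i\<^sub>j\<close> with \<open>j < a i\<close>. By the long exact sequence, exactness passes from \<open>P'\<close>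
to \<open>P\<close> as soon as two things hold.

\<^item> The forms \<open>f\<^sub>i\<^sub>j\<close> with \<open>j < a i\<close> are a regular sequence, which makes the Koszul complex exact
  (\<open>koszul_exact\<close>).
\<^item> If \<open>g f\<^sub>a\<close> lies in the ideal \<open>J'\<close> generated by the \<open>f\<^sub>b\<close> with \<open>b \<in> P'\<close>, then \<open>g\<close> lies in the ideal generated by the forms in the first item. Every \<open>b\<close> in \<open>P'\<close> has
  \<open>b i < a i\<close> for some \<open>i\<close>, because \<open>a\<close> is maximal; so \<open>J'\<close> is contained in that ideal, and it suffices
  that each factor \<open>f i (a i)\<close> of \<open>f\<^sub>a\<close> is a nonzerodivisor modulo it.

Both follow if, for each \<open>i\<close>, the vectors \<open>f\<^sub>k\<^sub>j\<close> with \<open>j < a k\<close> together with \<open>f i (a i)\<close> are linearly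
independent: when linear forms \<open>l\<^sub>1, \<dots>, l\<^sub>r, l\<close> are independent, a projection of the vector space that kills the \<open>l\<^sub>s\<close>
and fixes \<open>l\<close> induces an endomorphism of the polynomial ring whose kernel is the ideal of the \<open>l\<^sub>s\<close>, and multiplication
by \<open>l\<close> is injective on its image (\<open>nzd_mod_lin_form\<close>).

The independence is exactly the meaning of \<open>a \<in> D_arr\<close>. Its inequalities say that, for the vector \<open>c\<close> with \<open>c k = a k - 1\<close>
for \<open>k \<noteq> i\<close> and \<open>c i = a i\<close>, one has \<open>(\<Sum>k\<in>T. c k) \<le> rk T\<close> for all \<open>T\<close>. This is Rado's condition for
choosing \<open>c k\<close> vectors from each \<open>V k\<close> that are independent altogether (\<open>rado\<close>). A choice of this kind extends to a collection of bases,
and the genericity assumption transfers the dimension of its span to the given bases \<open>f\<close>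
(\<open>generic_bases_independent\<close>).

For calculations, a family \<open>A\<close> is the set \<open>{(i, j). j \<in> A\<^sub>i}\<close> of lattice points in lexicographic order,
a chain is the function sending each such set to its coefficient, and the differential is the Koszul
differential \<open>koszul_diff\<close> on these functions.\<close>

section \<open>Koszul complexes of sequences that are regular in every order\<close>

text \<open>For finite \<open>I\<close>, the ideal generated by the \<open>y p\<close> with \<open>p \<in> I\<close>, in the form in which Koszul chains produce its elements.\<close>

definition lin_combs :: "('p \<Rightarrow> 'r::comm_ring_1) \<Rightarrow> 'p set \<Rightarrow> 'r set" where
  "lin_combs y I = range (\<lambda>c. \<Sum>p\<in>I. y p * c p)"

text \<open>The element \<open>r\<close> is a nonzerodivisor modulo that ideal.\<close>

definition nzd_mod :: "('p \<Rightarrow> 'r::comm_ring_1) \<Rightarrow> 'p set \<Rightarrow> 'r \<Rightarrow> bool" where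
  "nzd_mod y I r \<longleftrightarrow> (\<forall>g. g * r \<in> lin_combs y I \<longrightarrow> g \<in> lin_combs y I)"

lemma lin_combsE: "g \<in> lin_combs y I \<Longrightarrow> (\<And>c. g = (\<Sum>p\<in>I. y p * c p) \<Longrightarrow> thesis) \<Longrightarrow> thesis"
  unfolding lin_combs_def by (erule rangeE)

lemma lin_combsI: "g = (\<Sum>p\<in>I. y p * c p) \<Longrightarrow> g \<in> lin_combs y I"
  unfolding lin_combs_def by (rule range_eqI[where x=c])

lemma lin_combs_add:
  assumes "g \<in> lin_combs y I" "h \<in> lin_combs y I"
  shows "g + h \<in> lin_combs y I"
proof -
  obtain c c' where "g = (\<Sum>p\<in>I. y p * c p)" "h = (\<Sum>p\<in>I. y p * c' p)"
    using assms by (auto simp: lin_combs_def)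
  then have "g + h = (\<Sum>p\<in>I. y p * (c p + c' p))"
    by (simp add: distrib_left sum.distrib)
  then show ?thesis by (rule lin_combsI)
qed

lemma lin_combs_mult:
  assumes "g \<in> lin_combs y I"
  shows "g * h \<in> lin_combs y I"
proof -
  obtain c where "g = (\<Sum>p\<in>I. y p * c p)"
    using assms by (auto simp: lin_combs_def)
  then have "g * h = (\<Sum>p\<in>I. y p * (c p * h))"
    by (simp add: sum_distrib_right mult.assoc)
  then show ?thesis by (rule lin_combsI)
qed

lemma lin_combs_0: "0 \<in> lin_combs y I"
  by (rule lin_combsI[where c="\<lambda>_. 0"]) simp

lemma lin_combs_uminus: "g \<in> lin_combs y I \<Longrightarrow> - g \<in> lin_combs y I"
  using lin_combs_mult[of g y I "-1"] by simp

lemma lin_combs_sum: "(\<And>a. a \<in> A \<Longrightarrow> g a \<in> lin_combs y I) \<Longrightarrow> sum g A \<in> lin_combs y I"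
  by (induction A rule: infinite_finite_induct) (simp_all add: lin_combs_0 lin_combs_add)

lemma lin_combs_generator: "finite I \<Longrightarrow> p \<in> I \<Longrightarrow> y p \<in> lin_combs y I"
  by (rule lin_combsI[where c="\<lambda>q. if q = p then 1 else 0"]) (simp add: if_distrib cong: if_cong)

lemma nzd_mod_prod:
  assumes "finite A" "\<And>a. a \<in> A \<Longrightarrow> nzd_mod y I (r a)"
  shows "nzd_mod y I (\<Prod>a\<in>A. r a)"
  using assms
proof (induction A)
  case (insert a A)
  show ?case
    unfolding nzd_mod_def
  proof (intro allI impI)
    fix g assume "g * (\<Prod>a\<in>insert a A. r a) \<in> lin_combs y I"
    then have "g * r a * (\<Prod>a\<in>A. r a) \<in> lin_combs y I"
      using insert.hyps by (simp add: mult.assoc)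
    moreover have "nzd_mod y I (\<Prod>a\<in>A. r a)" "nzd_mod y I (r a)"
      using insert.IH insert.prems by simp_all
    ultimately show "g \<in> lin_combs y I"
      unfolding nzd_mod_def by blast
  qed
qed (simp add: nzd_mod_def)

text \<open>The Koszul differential in coordinates: if \<open>z B\<close> is the coefficient of the basis element \<open>e\<^sub>B\<close> in a chain, this is the
  coefficient of \<open>e\<^sub>B\<close> in its boundary, to which the basis elements of the sets \<open>insert p B\<close> contribute. Values of
  \<open>z\<close> on sets of a different size do not interfere, so a function stands for a chain in every degree at once.\<close>

definition koszul_diff ::
  "('p::linorder \<Rightarrow> 'r::comm_ring_1) \<Rightarrow> 'p set \<Rightarrow> ('p set \<Rightarrow> 'r) \<Rightarrow> 'p set \<Rightarrow> 'r" where
  "koszul_diff y I z B = (\<Sum>p\<in>I - B. (-1) ^ card {c\<in>B. c < p} * y p * z (insert p B))"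

lemma koszul_diff_cong:
  assumes "\<And>p. p \<in> I \<Longrightarrow> p \<notin> B \<Longrightarrow> z (insert p B) = z' (insert p B)"
  shows "koszul_diff y I z B = koszul_diff y I z' B"
  unfolding koszul_diff_def using assms by (intro sum.cong) auto

lemma koszul_diff_minus:
  "koszul_diff y I (\<lambda>C. z C - z' C) B = koszul_diff y I z B - koszul_diff y I z' B"
  unfolding koszul_diff_def by (simp add: right_diff_distrib sum_subtractf)

text \<open>Adding first \<open>p\<close> and then \<open>q\<close> gives the same set as adding them in the other order, with the opposite sign.
  The sum is split into the pairs with \<open>p < q\<close> and those with \<open>q < p\<close>, because showing that the sum equals its own
  negative would not suffice in characteristic 2.\<close>

lemma koszul_diff_koszul_diff:
  assumes "finite I" "finite B"
  shows "koszul_diff y I (koszul_diff y I z) B = 0"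
proof -
  let ?S = "SIGMA p:I - B. I - insert p B"
  define t where "t = (\<lambda>(p, q). (-1) ^ card {c\<in>B. c < p} * y p *
      ((-1) ^ card {c\<in>insert p B. c < q} * y q * z (insert q (insert p B))))"
  define U where "U = {pq \<in> ?S. fst pq < snd pq}"
  define L where "L = {pq \<in> ?S. snd pq < fst pq}"
  have fin: "finite U" "finite L" using assms(1) by (auto simp: U_def L_def)
  have "koszul_diff y I (koszul_diff y I z) B = (\<Sum>pq\<in>?S. t pq)"
    unfolding koszul_diff_def t_def using assms(1)
    by (simp add: sum_distrib_left sum.Sigma)
  also have "?S = U \<union> L" by (auto simp: U_def L_def)
  also have "sum t (U \<union> L) = sum t U + sum t L"
    using fin by (intro sum.union_disjoint) (auto simp: U_def L_def)
  also have "sum t L = (\<Sum>pq\<in>U. - t pq)"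
  proof (rule sum.reindex_bij_witness[of _ prod.swap prod.swap])
    fix pq assume "pq \<in> L"
    then obtain p q where pq: "pq = (p, q)" "q < p" "p \<notin> B" "q \<notin> B"
      by (cases pq) (auto simp: L_def)
    have 1: "{c\<in>insert p B. c < q} = {c\<in>B. c < q}"
      using pq by auto
    have "{c\<in>insert q B. c < p} = insert q {c\<in>B. c < p}"
      using pq by auto
    then have 2: "card {c\<in>insert q B. c < p} = Suc (card {c\<in>B. c < p})"
      using assms(2) pq by simp
    show "- t (prod.swap pq) = t pq"
      unfolding pq t_def by (simp only: prod.swap_def fst_conv snd_conv case_prod_conv 1 2)
        (simp add: insert_commute[of p q] mult.left_commute mult.commute)
  qed (auto simp: U_def L_def)
  finally show ?thesis by (simp only: sum_negf add.right_inverse)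
qed

text \<open>Induction on the index set, adding its new maximum \<open>p\<close>: the Koszul complex of \<open>insert p I\<close> is the mapping cone of
  multiplication by \<open>y p\<close> on that of \<open>I\<close>. A cycle splits into \<open>u\<close> on sets without \<open>p\<close> and \<open>v\<close> on sets with \<open>p\<close>; here
  \<open>v\<close> is a cycle, hence a boundary (in degree 0 this is the nonzerodivisor property of \<open>y p\<close>), and after
  correction by it \<open>u\<close> is a cycle, hence a boundary as well.\<close>

theorem koszul_exact:
  assumes "finite I"
    and "\<And>J p. J \<subseteq> I \<Longrightarrow> p \<in> I - J \<Longrightarrow> nzd_mod y J (y p)"
    and "k \<ge> 1"
    and "\<And>B. B \<subseteq> I \<Longrightarrow> card B = k - 1 \<Longrightarrow> koszul_diff y I z B = 0"
  shows "\<exists>w. \<forall>B\<subseteq>I. card B = k \<longrightarrow> z B = koszul_diff y I w B"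
  using assms
proof (induction I arbitrary: k z rule: finite_linorder_max_induct)
  case empty
  then show ?case by (intro exI[of _ z]) auto
next
  case (insert p I)
  note fin = \<open>finite I\<close>
  have pI: "p \<notin> I" using insert.hyps(2) by auto
  have finB: "finite B" if "B \<subseteq> I" for B using that fin finite_subset by auto
  have without: "koszul_diff y (insert p I) u B = koszul_diff y I u B + (-1) ^ card B * y p * u (insert p B)"
    if "B \<subseteq> I" for u B
  proof -
    have "{c\<in>B. c < p} = B" using that insert.hyps(2) by auto
    moreover have "insert p I - B = insert p (I - B)" using that pI by auto
    ultimately show ?thesis using fin pI by (simp add: koszul_diff_def)
  qed
  have with_p: "koszul_diff y (insert p I) u (insert p C) = koszul_diff y I (\<lambda>B. u (insert p B)) C"
    if "C \<subseteq> I" for u C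
  proof -
    have "{c\<in>insert p C. c < q} = {c\<in>C. c < q}" if "q \<in> I" for q
      using that insert.hyps(2) by (auto dest: less_asym)
    moreover have "insert p I - insert p C = I - C" using pI by auto
    ultimately show ?thesis by (simp add: koszul_diff_def insert_commute)
  qed
  define v where "v = (\<lambda>C. z (insert p C))"
  have reg: "nzd_mod y J (y q)" if "J \<subseteq> I" "q \<in> I - J" for J q
    using insert.prems(1)[of J q] that by auto
  have cycle: "koszul_diff y I z B = - ((-1) ^ (k - 1) * y p * v B)" if "B \<subseteq> I" "card B = k - 1" for B
    using insert.prems(3)[of B] without[of B z] that unfolding v_def
    by (metis add_eq_0_iff2 subset_insertI2)
  have "\<exists>v'. \<forall>B\<subseteq>I. card B = k - 1 \<longrightarrow> v B = koszul_diff y I v' B"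
  proof (cases "k = 1")
    case True
    have "v {} * y p = (\<Sum>q\<in>I. y q * - z {q})"
      using cycle[of "{}"] True by (simp add: koszul_diff_def sum_negf mult.commute)
    then have "v {} \<in> lin_combs y I"
      using insert.prems(1)[of I p] pI by (metis Diff_iff insertI1 lin_combsI nzd_mod_def subset_insertI)
    then obtain c where "v {} = (\<Sum>q\<in>I. y q * c q)" by (rule lin_combsE)
    then have "v {} = koszul_diff y I (\<lambda>B. c (the_elem B)) {}" by (simp add: koszul_diff_def)
    then show ?thesis using True finB by (intro exI[of _ "\<lambda>B. c (the_elem B)"]) auto
  next
    case False
    show ?thesis
    proof (rule insert.IH[OF reg])
      fix C assume C: "C \<subseteq> I" "card C = k - 1 - 1"
      then have "card (insert p C) = k - 1"
        using False \<open>k \<ge> 1\<close> finB pI by (subst card_insert_disjoint) auto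
      then show "koszul_diff y I v C = 0"
        using insert.prems(3)[of "insert p C"] with_p[of C z] C unfolding v_def by auto
    qed (use False \<open>k \<ge> 1\<close> in auto)
  qed
  then obtain v' where v': "\<And>B. B \<subseteq> I \<Longrightarrow> card B = k - 1 \<Longrightarrow> v B = koszul_diff y I v' B" by blast
  have "\<exists>u'. \<forall>B\<subseteq>I. card B = k \<longrightarrow> z B - (-1) ^ k * y p * v' B = koszul_diff y I u' B"
  proof (rule insert.IH[OF reg])
    fix B assume B: "B \<subseteq> I" "card B = k - 1"
    have "koszul_diff y I (\<lambda>B. (-1) ^ k * y p * v' B) B = (-1) ^ k * y p * koszul_diff y I v' B"
      by (simp add: koszul_diff_def sum_distrib_left algebra_simps)
    also have "\<dots> = - ((-1) ^ (k - 1) * y p * v B)"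
      using \<open>k \<ge> 1\<close> v'[OF B] by (cases k) auto
    finally show "koszul_diff y I (\<lambda>B. z B - (-1) ^ k * y p * v' B) B = 0"
      using cycle[OF B] by (simp add: koszul_diff_minus)
  qed (use \<open>k \<ge> 1\<close> in auto)
  then obtain u' where
    u': "\<And>B. B \<subseteq> I \<Longrightarrow> card B = k \<Longrightarrow> z B - (-1) ^ k * y p * v' B = koszul_diff y I u' B" by blast
  \<comment> \<open>The sign in \<open>u'\<close> is the one with which \<open>y p\<close> times \<open>v'\<close> enters the boundary of \<open>w\<close> at sets of size \<open>k\<close>.\<close>
  define w where "w = (\<lambda>B. if p \<in> B then v' (B - {p}) else u' B)"
  have w_without: "koszul_diff y I w C = koszul_diff y I u' C" if "C \<subseteq> I" for C
    using that pI unfolding w_def by (intro koszul_diff_cong) auto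
  have w_with: "w (insert p C) = v' C" if "C \<subseteq> I" for C
  proof -
    have "insert p C - {p} = C" using that pI by auto
    then show ?thesis by (simp add: w_def)
  qed
  show ?case
  proof (intro exI allI impI)
    fix B assume B: "B \<subseteq> insert p I" "card B = k"
    show "z B = koszul_diff y (insert p I) w B"
    proof (cases "p \<in> B")
      case False
      then have "B \<subseteq> I" using B by auto
      then have "koszul_diff y (insert p I) w B = koszul_diff y I u' B + (-1) ^ k * y p * v' B"
        using B w_without w_with by (simp add: without)
      then show ?thesis using u'[OF \<open>B \<subseteq> I\<close> B(2)] by (metis diff_add_cancel)
    next
      case True
      define C where "C = B - {p}"
      have C: "C \<subseteq> I" "B = insert p C" using B True by (auto simp: C_def)
      have "p \<notin> C" by (simp add: C_def)
      then have "card C = k - 1" using B(2) C finB[of C] by simp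
      have "koszul_diff y (insert p I) w B = koszul_diff y I v' C"
        unfolding C(2) with_p[OF C(1)] using C(1) w_with by (intro koszul_diff_cong) auto
      then show ?thesis using v'[OF C(1) \<open>card C = k - 1\<close>] C(2) by (simp add: v_def)
    qed
  qed
qed

section \<open>Cells: the basis of the complex as sets of lattice points\<close>

definition box :: "('n \<Rightarrow> nat) \<Rightarrow> ('n \<times> nat) set" where
  "box d = (SIGMA i:UNIV. {1..d i})"

definition below :: "('n \<Rightarrow> nat) \<Rightarrow> ('n \<times> nat) set" where
  "below a = (SIGMA i:UNIV. {1..<a i})"

definition graph :: "('n \<Rightarrow> nat) \<Rightarrow> ('n \<times> nat) set" where
  "graph a = range (\<lambda>i. (i, a i))"

text \<open>Sets in which every index occurs correspond to the families \<open>A\<close> with all \<open>A\<^sub>i\<close> nonempty.\<close>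

definition full :: "('n \<times> nat) set \<Rightarrow> bool" where
  "full C \<longleftrightarrow> (\<forall>i. C `` {i} \<noteq> {})"

definition corner :: "('n \<times> nat) set \<Rightarrow> 'n \<Rightarrow> nat" where
  "corner C i = Max (C `` {i})"

text \<open>The sets that correspond to the basis elements of the complex of \<open>P\<close> in positive degrees.\<close>

definition cells :: "('n \<Rightarrow> nat) \<Rightarrow> ('n \<Rightarrow> nat) set \<Rightarrow> ('n \<times> nat) set set" where
  "cells d P = {C. C \<subseteq> box d \<and> full C \<and> corner C \<in> P}"

text \<open>The sign of the complex counts \<open>\<Sum>j<i. |A\<^sub>j| - 1\<close> points in earlier rows, the Koszul sign on sets of pairs counts
  \<open>\<Sum>j<i. |A\<^sub>j|\<close>. The difference is the number of rows before \<open>i\<close>, which depends on the variable only, so it can be absorbed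
  into the sequence.\<close>

definition twist :: "('n::{finite,linorder} \<times> nat \<Rightarrow> 'r::comm_ring_1) \<Rightarrow> 'n \<times> nat \<Rightarrow> 'r" where
  "twist y p = (-1) ^ card {..<fst p} * y p"

text \<open>On full sets this is the differential of the complex: the summands of the Koszul differential that land in full
  sets come from full sets only.\<close>

definition face_sum :: "('n::{finite,linorder} \<Rightarrow> nat) \<Rightarrow> ('n \<times> nat \<Rightarrow> 'r::comm_ring_1) \<Rightarrow>
    (('n \<times> nat) set \<Rightarrow> 'r) \<Rightarrow> ('n \<times> nat) set \<Rightarrow> 'r" where
  "face_sum d y = koszul_diff (twist y) (box d)"

lemma finite_box: "finite (box (d :: 'n::finite \<Rightarrow> nat))"
  by (simp add: box_def)

lemma finite_below: "finite (below (a :: 'n::finite \<Rightarrow> nat))"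
  by (simp add: below_def)

lemma finite_cells: "finite (cells (d :: 'n::finite \<Rightarrow> nat) P)"
  by (rule finite_subset[of _ "Pow (box d)"]) (auto simp: cells_def finite_box)

lemma finite_subset_box: "C \<subseteq> box (d :: 'n::finite \<Rightarrow> nat) \<Longrightarrow> finite C"
  using finite_box finite_subset by blast

lemma finite_fibre: "finite C \<Longrightarrow> finite (C `` {i})"
  by (rule finite_subset[of _ "snd ` C"]) force+

lemma full_mono: "full C \<Longrightarrow> C \<subseteq> C' \<Longrightarrow> full C'"
  unfolding full_def by blast

lemma corner_mono: "C \<subseteq> C' \<Longrightarrow> full C \<Longrightarrow> finite C' \<Longrightarrow> corner C \<le> corner C'"
  unfolding corner_def full_def le_fun_def by (auto intro!: Max_mono finite_fibre)

lemma corner_mem: "full C \<Longrightarrow> finite C \<Longrightarrow> (i, corner C i) \<in> C"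
  unfolding corner_def full_def using Max_in[OF finite_fibre, of C i] by auto

lemma le_corner: "(i, j) \<in> C \<Longrightarrow> finite C \<Longrightarrow> j \<le> corner C i"
  unfolding corner_def by (auto intro!: Max_ge finite_fibre)

lemma corner_in_D_box:
  fixes d :: "'n::finite \<Rightarrow> nat"
  assumes "C \<subseteq> box d" "full C"
  shows "corner C \<in> D_box d"
  using corner_mem[OF assms(2) finite_subset_box[OF assms(1)]] assms(1)
  unfolding D_box_def box_def by blast

lemma cells_downward_closed:
  fixes d :: "'n::finite \<Rightarrow> nat"
  assumes "poset_ideal d P" "C' \<in> cells d P" "C \<subseteq> C'" "full C"
  shows "C \<in> cells d P"
proof -
  have "C' \<subseteq> box d" "C \<subseteq> box d" "corner C' \<in> P" using assms by (auto simp: cells_def)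
  moreover have "corner C \<le> corner C'"
    using assms \<open>C' \<subseteq> box d\<close> by (intro corner_mono) (auto intro: finite_subset_box)
  ultimately show ?thesis
    using assms corner_in_D_box[of C d] unfolding cells_def poset_ideal_def by blast
qed

lemma graph_subset_box: "a \<in> D_box d \<Longrightarrow> graph a \<subseteq> box d"
  by (auto simp: graph_def box_def D_box_def)

lemma finite_graph: "finite (graph (a :: 'n::finite \<Rightarrow> nat))"
  by (simp add: graph_def)

lemma card_graph: "card (graph (a :: 'n::finite \<Rightarrow> nat)) = CARD('n)"
  unfolding graph_def by (rule card_image) (simp add: inj_on_def)

lemma full_graph: "full (graph a)"
  by (auto simp: full_def graph_def)

lemma below_graph_disjoint: "below a \<inter> graph a = {}"
  by (auto simp: below_def graph_def)

lemma corner_below_graph: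
  fixes a :: "'n::finite \<Rightarrow> nat"
  assumes "B \<subseteq> below a"
  shows "corner (B \<union> graph a) = a"
proof
  fix i
  have "finite B" using assms finite_below finite_subset by blast
  then show "corner (B \<union> graph a) i = a i"
    unfolding corner_def using assms
    by (intro Max_eqI finite_fibre) (auto simp: graph_def below_def finite_graph)
qed

lemma cells_below_graph:
  fixes d :: "'n::finite \<Rightarrow> nat"
  assumes "B \<subseteq> below a" "a \<in> D_box d"
  shows "B \<union> graph a \<subseteq> box d" "full (B \<union> graph a)" "card (B \<union> graph a) = card B + CARD('n)"
    "(B \<union> graph a) - graph a = B"
proof -
  show "B \<union> graph a \<subseteq> box d"
  proof -
    have "a i \<le> d i" for i using assms(2) by (simp add: D_box_def)
    then have "below a \<subseteq> box d"
      by (auto simp: below_def box_def) (meson less_imp_le order_trans)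
    then show ?thesis using assms(1) graph_subset_box[OF assms(2)] by blast
  qed
  show "full (B \<union> graph a)" using full_mono[OF full_graph] by blast
  have "finite B" using assms finite_below finite_subset by blast
  moreover have "B \<inter> graph a = {}" using assms below_graph_disjoint by blast
  ultimately show "card (B \<union> graph a) = card B + CARD('n)"
    by (simp add: card_Un_disjoint finite_graph card_graph)
  show "(B \<union> graph a) - graph a = B" using \<open>B \<inter> graph a = {}\<close> by blast
qed

lemma full_decomposition:
  fixes C :: "('n::finite \<times> nat) set"
  assumes "C \<subseteq> box d" "full C"
  shows "C - graph (corner C) \<subseteq> below (corner C)" "C = (C - graph (corner C)) \<union> graph (corner C)"
proof -
  have fin: "finite C" using assms finite_subset_box by blast
  have "graph (corner C) \<subseteq> C" using corner_mem[OF assms(2) fin] by (auto simp: graph_def)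
  then show "C = (C - graph (corner C)) \<union> graph (corner C)" by blast
  show "C - graph (corner C) \<subseteq> below (corner C)"
  proof
    fix p assume "p \<in> C - graph (corner C)"
    then obtain i j where p: "p = (i, j)" "(i, j) \<in> C" "j \<noteq> corner C i"
      by (cases p) (auto simp: graph_def)
    then show "p \<in> below (corner C)"
      using le_corner[OF p(2) fin] assms(1) by (auto simp: below_def box_def)
  qed
qed

lemma full_card_graph:
  fixes C :: "('n::finite \<times> nat) set"
  assumes "C \<subseteq> box d" "full C" "card C = CARD('n)"
  shows "C = graph (corner C)"
proof -
  have "card (graph (corner C)) = card C" by (simp add: card_graph assms(3))
  moreover have "graph (corner C) \<subseteq> C" using full_decomposition[OF assms(1,2)] by blast
  moreover have "finite C" using assms finite_subset_box by blast
  ultimately show ?thesis by (metis card_subset_eq)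
qed

lemma corner_graph: "corner (graph a) = (a :: 'n::finite \<Rightarrow> nat)"
  using corner_below_graph[of "{}" a] by simp

lemma graph_in_cells:
  "a \<in> D_box d \<Longrightarrow> graph a \<in> cells d P \<longleftrightarrow> (a :: 'n::finite \<Rightarrow> nat) \<in> P"
  by (simp add: cells_def graph_subset_box full_graph corner_graph)

lemma card_graph_less:
  fixes a :: "'n::{finite,linorder} \<Rightarrow> nat"
  shows "card {c \<in> graph a. c < (i, j)} = card {..<i} + (if a i < j then 1 else 0)"
proof -
  let ?I = "{..<i} \<union> (if a i < j then {i} else {})"
  have "(k, a k) < (i, j) \<longleftrightarrow> k \<in> ?I" for k
    by (auto simp: order.order_iff_strict)
  then have "{c \<in> graph a. c < (i, j)} = (\<lambda>k. (k, a k)) ` ?I"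
    by (auto simp only: graph_def)
  moreover have "card ((\<lambda>k. (k, a k)) ` ?I) = card ?I"
    by (rule card_image) (simp add: inj_on_def)
  ultimately show ?thesis by simp
qed

lemma neg_one_power_cancel: "(-1) ^ m * ((-1) ^ m * r) = (r :: 'r::comm_ring_1)"
  by (simp flip: mult.assoc power_mult_distrib)

text \<open>The quotient by the subcomplex of \<open>P - {a}\<close> is the Koszul complex of \<open>below a\<close>. A point outside \<open>below a\<close>
  can be added to \<open>B \<union> graph a\<close> only by raising the corner above \<open>a\<close>, where \<open>z\<close> vanishes; for the points of
  \<open>below a\<close>, the points of \<open>graph a\<close> in earlier rows cancel the sign in \<open>twist\<close>.\<close>

lemma face_sum_maximal:
  fixes d :: "'n::{finite,linorder} \<Rightarrow> nat"
  assumes "a \<in> D_box d" and maximal: "\<And>b. b \<in> P \<Longrightarrow> a \<le> b \<Longrightarrow> b = a"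
    and supp: "\<And>C. C \<notin> cells d P \<Longrightarrow> z C = 0"
    and B: "B \<subseteq> below a"
  shows "face_sum d y z (B \<union> graph a) = koszul_diff y (below a) (\<lambda>B. z (B \<union> graph a)) B"
proof -
  let ?G = "B \<union> graph a"
  have box: "below a \<subseteq> box d" using assms(1) cells_below_graph(1)[of "below a" a d] by auto
  have finB: "finite B" using B finite_below finite_subset by blast
  have "face_sum d y z ?G = (\<Sum>p\<in>below a - B. (-1) ^ card {c\<in>?G. c < p} * twist y p * z (insert p ?G))"
    unfolding face_sum_def koszul_diff_def
  proof (rule sum.mono_neutral_right)
    show "finite (box d - ?G)" by (simp add: finite_box)
    show "below a - B \<subseteq> box d - ?G" using box below_graph_disjoint by blast
    have "z (insert p ?G) = 0" if p: "p \<in> box d - ?G" "p \<notin> below a" for p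
    proof (rule ccontr)
      assume "z (insert p ?G) \<noteq> 0"
      then have "corner (insert p ?G) \<in> P" using supp by (force simp: cells_def)
      moreover have "a \<le> corner (insert p ?G)"
        using corner_mono[of "?G" "insert p ?G"] finB B cells_below_graph(2)[OF B assms(1)]
        by (auto simp: finite_graph corner_below_graph)
      ultimately have *: "corner (insert p ?G) = a" using maximal by blast
      obtain i j where ij: "p = (i, j)" by (cases p)
      have "j \<le> a i" using le_corner[of i j "insert p ?G"] * ij finB finite_graph by auto
      then show False using p ij by (auto simp: box_def below_def graph_def)
    qed
    moreover have "p \<in> box d - ?G" "p \<notin> below a" if "p \<in> (box d - ?G) - (below a - B)" for p
      using that by auto
    ultimately show "\<forall>p\<in>(box d - ?G) - (below a - B). (-1) ^ card {c\<in>?G. c < p} * twist y p * z (insert p ?G) = 0"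
      by (metis (no_types, lifting) mult_zero_right)
  qed
  also have "\<dots> = koszul_diff y (below a) (\<lambda>B. z (B \<union> graph a)) B"
    unfolding koszul_diff_def
  proof (rule sum.cong[OF refl])
    fix p assume "p \<in> below a - B"
    then obtain i j where p: "p = (i, j)" "j < a i" by (cases p) (auto simp: below_def)
    have "{c\<in>?G. c < p} = {c\<in>B. c < p} \<union> {c\<in>graph a. c < p}" by auto
    moreover have "{c\<in>B. c < p} \<inter> {c\<in>graph a. c < p} = {}" using B below_graph_disjoint by blast
    ultimately have "card {c\<in>?G. c < p} = card {c\<in>B. c < p} + card {..<i}"
      using finB finite_graph[of a] p card_graph_less[of a i j] by (simp add: card_Un_disjoint)
    then show "(-1) ^ card {c\<in>?G. c < p} * twist y p * z (insert p ?G) =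
        (-1) ^ card {c\<in>B. c < p} * y p * z (insert p B \<union> graph a)"
      by (simp add: twist_def p power_add mult.assoc neg_one_power_cancel)
  qed
  finally show ?thesis .
qed

lemma finite_D_box: "finite (D_box (d :: 'n::finite \<Rightarrow> nat))"
proof -
  have "D_box d \<subseteq> {a. \<forall>i. (i \<in> UNIV \<longrightarrow> a i \<in> {..Max (range d)}) \<and> (i \<notin> UNIV \<longrightarrow> a i = 0)}"
    by (auto simp: D_box_def intro: order_trans)
  then show ?thesis
    by (rule finite_subset) (intro finite_set_of_finite_funs finite finite_atMost)
qed

text \<open>The composition of the differential with the augmentation. A set with exactly two points in one row and one point in each of the
  others is obtained from two graphs by adding a point, and both give the product of the \<open>y\<close> over all its points, with opposite signs.
  As before, the two kinds of pairs are separated to be independent of the characteristic.\<close>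

lemma augmentation_face_sum:
  fixes d :: "'n::{finite,linorder} \<Rightarrow> nat"
  assumes "poset_ideal d P" and supp: "\<And>C. C \<notin> cells d P \<Longrightarrow> w C = 0"
  shows "(\<Sum>a\<in>P. face_sum d y w (graph a) * (\<Prod>i\<in>UNIV. y (i, a i))) = 0"
proof -
  define t where "t = (\<lambda>(a, p). (-1) ^ card {c\<in>graph a. c < p} * twist y p * w (insert p (graph a)) *
      (\<Prod>i\<in>UNIV. y (i, a i)))"
  let ?S = "SIGMA a:D_box d. box d - graph a"
  define U where "U = {s \<in> ?S. fst s (fst (snd s)) < snd (snd s)}"
  define L where "L = {s \<in> ?S. snd (snd s) < fst s (fst (snd s))}"
  define swap :: "('n \<Rightarrow> nat) \<times> 'n \<times> nat \<Rightarrow> ('n \<Rightarrow> nat) \<times> 'n \<times> nat"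
    where "swap = (\<lambda>(a, i, j). (a(i := j), i, a i))"
  have PD: "P \<subseteq> D_box d" using assms(1) by (simp add: poset_ideal_def)
  \<comment> \<open>Summing over all of \<open>D_box d\<close> makes the index set closed under the exchange of the two points.\<close>
  have outside: "face_sum d y w (graph a) = 0" if "a \<in> D_box d - P" for a
  proof -
    have "w (insert p (graph a)) = 0" for p
      using cells_downward_closed[OF assms(1), of "insert p (graph a)" "graph a"]
        that graph_in_cells[of a d P] full_graph[of a] supp by blast
    then show ?thesis by (simp add: face_sum_def koszul_diff_def)
  qed
  have "(\<Sum>a\<in>P. face_sum d y w (graph a) * (\<Prod>i\<in>UNIV. y (i, a i))) =
      (\<Sum>a\<in>D_box d. face_sum d y w (graph a) * (\<Prod>i\<in>UNIV. y (i, a i)))"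
    using PD outside by (intro sum.mono_neutral_left) (auto simp: finite_D_box)
  also have "\<dots> = (\<Sum>s\<in>?S. t s)"
    unfolding face_sum_def koszul_diff_def t_def
    by (simp add: sum_distrib_right sum.Sigma finite_box finite_D_box)
  also have "?S = U \<union> L" by (force simp: U_def L_def graph_def)
  also have "sum t (U \<union> L) = sum t U + sum t L"
  proof (rule sum.union_disjoint)
    have "finite ?S" by (simp add: finite_box finite_D_box)
    then show "finite U" "finite L" by (simp_all add: U_def L_def)
  qed (auto simp: U_def L_def)
  also have "sum t L = (\<Sum>s\<in>U. - t s)"
  proof (rule sum.reindex_bij_witness[of _ swap swap])
    fix s assume "s \<in> L"
    then obtain a i j where s: "s = (a, i, j)" "j < a i"
      by (cases s) (auto simp: L_def)
    have "insert (i, a i) (graph (a(i := j))) = insert (i, j) (graph a)"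
      by (auto simp: graph_def)
    moreover have "y (i, j) * (\<Prod>k\<in>UNIV. y (k, a k)) = y (i, a i) * (\<Prod>k\<in>UNIV. y (k, (a(i := j)) k))"
      by (simp add: prod.remove[of UNIV i])
    ultimately show "- t (swap s) = t s"
      unfolding s t_def swap_def using s(2)
      by (simp add: card_graph_less twist_def mult.assoc neg_one_power_cancel power_add
          mult.left_commute[of _ "w (insert (i, j) (graph a))"])
  qed (auto simp: U_def L_def swap_def D_box_def box_def graph_def split: if_splits)
  finally show ?thesis by (simp only: sum_negf add.right_inverse)
qed

section \<open>Exactness by adding maximal elements to the poset ideal\<close>

lemma face_sum_cong:
  assumes "\<And>p. p \<in> box d \<Longrightarrow> p \<notin> C \<Longrightarrow> z (insert p C) = z' (insert p C)"
  shows "face_sum d y z C = face_sum d y z' C"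
  unfolding face_sum_def using assms by (rule koszul_diff_cong)

lemma face_sum_add:
  "face_sum d y (\<lambda>C. z C + z' C) C = face_sum d y z C + face_sum d y z' C"
  unfolding face_sum_def koszul_diff_def by (simp add: distrib_left sum.distrib)

lemma face_sum_minus:
  "face_sum d y (\<lambda>C. z C - z' C) C = face_sum d y z C - face_sum d y z' C"
  unfolding face_sum_def by (rule koszul_diff_minus)

lemma face_sum_face_sum:
  "C \<subseteq> box d \<Longrightarrow> face_sum d y (face_sum d y z) C = 0"
  unfolding face_sum_def by (rule koszul_diff_koszul_diff) (auto simp: finite_box finite_subset_box)

lemma face_sum_outside_cells:
  fixes d :: "'n::{finite,linorder} \<Rightarrow> nat"
  assumes "poset_ideal d P" "\<And>C. C \<notin> cells d P \<Longrightarrow> z C = 0" "full C" "C \<notin> cells d P"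
  shows "face_sum d y z C = 0"
proof -
  have "z (insert p C) = 0" for p
    using cells_downward_closed[OF assms(1), of "insert p C" C] assms by blast
  then show ?thesis by (simp add: face_sum_def koszul_diff_def)
qed

text \<open>The induction on \<open>P\<close>: a cycle \<open>z\<close> restricts to a Koszul cycle on the cells with corner \<open>a\<close>, so it is a boundary there, and
  after subtracting a boundary \<open>\<partial>w1\<close> it is supported on the cells of \<open>P - {a}\<close>. In degree \<open>k = 0\<close>, where a cycle is a
  relation \<open>\<Sum>a\<in>P. z\<^sub>a f\<^sub>a = 0\<close>, the coefficient of \<open>f\<^sub>a\<close> lies in the ideal of \<open>below a\<close>
  because all other \<open>f\<^sub>b\<close> do and \<open>f\<^sub>a\<close> is a nonzerodivisor modulo it.\<close>

theorem face_sum_exact: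
  fixes d :: "'n::{finite,linorder} \<Rightarrow> nat" and y :: "'n \<times> nat \<Rightarrow> 'r::comm_ring_1"
  assumes "poset_ideal d P"
    and "\<And>a J p. a \<in> P \<Longrightarrow> J \<subseteq> below a \<Longrightarrow> p \<in> below a - J \<Longrightarrow> nzd_mod y J (y p)"
    and "\<And>a i. a \<in> P \<Longrightarrow> nzd_mod y (below a) (y (i, a i))"
    and "\<And>C. C \<notin> cells d P \<Longrightarrow> z C = 0"
    and "\<And>C. C \<subseteq> box d \<Longrightarrow> full C \<Longrightarrow> Suc (card C) = k + CARD('n) \<Longrightarrow> face_sum d y z C = 0"
    and "k = 0 \<Longrightarrow> (\<Sum>a\<in>P. z (graph a) * (\<Prod>i\<in>UNIV. y (i, a i))) = 0"
  shows "\<exists>w. (\<forall>C. C \<notin> cells d P \<longrightarrow> w C = 0) \<and>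
    (\<forall>C. C \<subseteq> box d \<longrightarrow> full C \<longrightarrow> card C = k + CARD('n) \<longrightarrow> z C = face_sum d y w C)"
proof -
  have "finite P" using assms(1) finite_D_box[of d] finite_subset unfolding poset_ideal_def by blast
  then show ?thesis using assms
  proof (induction P arbitrary: z rule: finite_psubset_induct)
    case (psubset P)
    note ideal = psubset.prems(1) and regular = psubset.prems(2) and corner_regular = psubset.prems(3)
      and supp = psubset.prems(4) and cycle = psubset.prems(5) and aug = psubset.prems(6)
    show ?case
    proof (cases "P = {}")
      case True
      then have "z C = 0" for C using supp by (simp add: cells_def)
      then show ?thesis by (intro exI[of _ "\<lambda>_. 0"]) (simp add: face_sum_def koszul_diff_def)
    next
      case False
      then obtain a where a: "a \<in> P" and maximal: "\<And>b. b \<in> P \<Longrightarrow> a \<le> b \<Longrightarrow> b = a"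
        using finite_has_maximal[OF psubset.hyps(1)] by metis
      have PD: "P \<subseteq> D_box d" using ideal by (simp add: poset_ideal_def)
      then have aD: "a \<in> D_box d" using a by blast
      define P' where "P' = P - {a}"
      have ideal': "poset_ideal d P'"
        using ideal maximal unfolding poset_ideal_def P'_def by blast
      have cells': "C \<in> cells d P' \<longleftrightarrow> C \<in> cells d P \<and> corner C \<noteq> a" for C
        by (auto simp: cells_def P'_def)
      let ?Y = "\<lambda>b. \<Prod>i\<in>UNIV. y (i, b i)"
      have "\<exists>w0. \<forall>B\<subseteq>below a. card B = k \<longrightarrow> z (B \<union> graph a) = koszul_diff y (below a) w0 B"
      proof (cases "k = 0")
        case True
        have Y': "?Y b \<in> lin_combs y (below a)" if b: "b \<in> P'" for b
        proof -
          have "\<not> a \<le> b" using maximal b by (auto simp: P'_def)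
          then obtain i where "b i < a i" by (auto simp: le_fun_def not_le)
          moreover have "b i \<ge> 1" using b PD by (auto simp: P'_def D_box_def)
          ultimately have "y (i, b i) \<in> lin_combs y (below a)"
            by (intro lin_combs_generator finite_below) (simp add: below_def)
          then show ?thesis by (simp add: prod.remove[of UNIV i] lin_combs_mult)
        qed
        have "z (graph a) * ?Y a = - (\<Sum>b\<in>P'. z (graph b) * ?Y b)"
          using aug[OF True] sum.remove[OF psubset.hyps(1) a, of "\<lambda>b. z (graph b) * ?Y b"]
          by (simp add: P'_def eq_neg_iff_add_eq_0)
        also have "\<dots> \<in> lin_combs y (below a)"
          by (intro lin_combs_uminus lin_combs_sum)
            (simp add: mult.commute[of "z _"] lin_combs_mult Y')
        finally have "z (graph a) * ?Y a \<in> lin_combs y (below a)" .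
        moreover have "nzd_mod y (below a) (?Y a)"
          by (rule nzd_mod_prod) (simp_all add: corner_regular[OF a])
        ultimately have "z (graph a) \<in> lin_combs y (below a)"
          unfolding nzd_mod_def by blast
        then obtain c where "z (graph a) = (\<Sum>p\<in>below a. y p * c p)" by (rule lin_combsE)
        then have "z (graph a) = koszul_diff y (below a) (\<lambda>B. c (the_elem B)) {}"
          by (simp add: koszul_diff_def)
        moreover have "B = {}" if "B \<subseteq> below a" "card B = k" for B
          using that True finite_below finite_subset by fastforce
        ultimately show ?thesis by (metis sup_bot_left)
      next
        case False
        show ?thesis
        proof (rule koszul_exact)
          fix B assume B: "B \<subseteq> below a" "card B = k - 1"
          have "face_sum d y z (B \<union> graph a) = 0"
            using cells_below_graph(1-3)[OF B(1) aD] B(2) False by (intro cycle) auto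
          then show "koszul_diff y (below a) (\<lambda>B. z (B \<union> graph a)) B = 0"
            using face_sum_maximal[OF aD maximal supp B(1)] by simp
        qed (use False finite_below regular[OF a] in auto)
      qed
      then obtain w0 where w0: "\<And>B. B \<subseteq> below a \<Longrightarrow> card B = k \<Longrightarrow>
          z (B \<union> graph a) = koszul_diff y (below a) w0 B" by blast
      define w1 where "w1 = (\<lambda>C. if C \<in> cells d P \<and> corner C = a then w0 (C - graph a) else 0)"
      have w1_supp: "w1 C = 0" if "C \<notin> cells d P" for C using that by (simp add: w1_def)
      have w1_graph: "w1 (B \<union> graph a) = w0 B" if "B \<subseteq> below a" for B
        using cells_below_graph[OF that aD] corner_below_graph[OF that] a
        by (simp add: w1_def cells_def)
      \<comment> \<open>\<open>w1\<close> lives on the cells with corner \<open>a\<close> only, where the differential is the Koszul differential up to lower cells.\<close>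
      have w1: "face_sum d y w1 (B \<union> graph a) = z (B \<union> graph a)"
        if B: "B \<subseteq> below a" "card B = k" for B
      proof -
        have "face_sum d y w1 (B \<union> graph a) = koszul_diff y (below a) (\<lambda>B. w1 (B \<union> graph a)) B"
          using aD maximal w1_supp B(1) by (rule face_sum_maximal)
        also have "\<dots> = koszul_diff y (below a) w0 B"
          using w1_graph B(1) by (intro koszul_diff_cong) blast
        finally show ?thesis using w0[OF B] by simp
      qed
      define z1 where "z1 = (\<lambda>C. if C \<in> cells d P' then z C - face_sum d y w1 C else 0)"
      \<comment> \<open>In the relevant degree, \<open>z - \<partial>w1\<close> vanishes on all cells whose corner is not in \<open>P'\<close>.\<close>
      have z1: "z1 C = z C - face_sum d y w1 C"
        if C: "C \<subseteq> box d" "full C" "card C = k + CARD('n)" for C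
      proof (cases "C \<in> cells d P")
        case False
        then show ?thesis
          using supp face_sum_outside_cells[OF ideal w1_supp C(2)] by (simp add: z1_def cells')
      next
        case True
        show ?thesis
        proof (cases "corner C = a")
          case False
          then show ?thesis using True by (simp add: z1_def cells')
        next
          case C_corner: True
          define B where "B = C - graph a"
          have B: "B \<subseteq> below a" "C = B \<union> graph a"
            using full_decomposition[OF C(1,2)] unfolding C_corner B_def by auto
          then have "card B = k" using cells_below_graph(3)[OF B(1) aD] C(3) by simp
          then show ?thesis using w1[OF B(1)] C_corner B(2) by (simp add: z1_def cells')
        qed
      qed
      have "\<exists>w2. (\<forall>C. C \<notin> cells d P' \<longrightarrow> w2 C = 0) \<and>
        (\<forall>C. C \<subseteq> box d \<longrightarrow> full C \<longrightarrow> card C = k + CARD('n) \<longrightarrow> z1 C = face_sum d y w2 C)"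
      proof (rule psubset.IH[of P'])
        fix C assume C: "C \<subseteq> box d" "full C" "Suc (card C) = k + CARD('n)"
        have "face_sum d y z1 C = face_sum d y (\<lambda>C. z C - face_sum d y w1 C) C"
        proof (rule face_sum_cong)
          fix p assume "p \<in> box d" "p \<notin> C"
          then show "z1 (insert p C) = z (insert p C) - face_sum d y w1 (insert p C)"
            using C finite_subset_box[OF C(1)] full_mono[OF C(2) subset_insertI]
            by (intro z1) auto
        qed
        then show "face_sum d y z1 C = 0"
          using cycle[OF C] by (simp add: face_sum_minus face_sum_face_sum[OF C(1)])
      next
        assume k: "k = 0"
        let ?t = "\<lambda>b. (z (graph b) - face_sum d y w1 (graph b)) * ?Y b"
        have "z1 (graph b) = z (graph b) - face_sum d y w1 (graph b)" if "b \<in> P'" for b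
          using PD k that
          by (intro z1 graph_subset_box full_graph) (auto simp: card_graph P'_def)
        then have "(\<Sum>b\<in>P'. z1 (graph b) * ?Y b) = (\<Sum>b\<in>P'. ?t b)"
          by simp
        also have "\<dots> = (\<Sum>b\<in>P. ?t b)"
          using sum.remove[OF psubset.hyps(1) a, of ?t] w1[of "{}"] k by (simp add: P'_def)
        also have "\<dots> = 0"
          using aug[OF k] augmentation_face_sum[OF ideal w1_supp]
          by (simp add: left_diff_distrib sum_subtractf)
        finally show "(\<Sum>b\<in>P'. z1 (graph b) * ?Y b) = 0" .
      qed (use ideal' regular corner_regular a in \<open>auto simp: P'_def z1_def\<close>)
      then obtain w2 where w2: "\<And>C. C \<notin> cells d P' \<Longrightarrow> w2 C = 0"
        "\<And>C. C \<subseteq> box d \<Longrightarrow> full C \<Longrightarrow> card C = k + CARD('n) \<Longrightarrow> z1 C = face_sum d y w2 C"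
        by blast
      show ?thesis
      proof (intro exI conjI allI impI)
        fix C assume "C \<notin> cells d P"
        then show "w1 C + w2 C = 0" using w1_supp w2(1) by (simp add: cells')
      next
        fix C assume C: "C \<subseteq> box d" "full C" "card C = k + CARD('n)"
        show "z C = face_sum d y (\<lambda>C. w1 C + w2 C) C"
          using w2(2)[OF C] z1[OF C] by (simp add: face_sum_add algebra_simps)
      qed
    qed
  qed
qed

section \<open>The free complex and its differential in coordinates\<close>

definition cell_gen :: "('n \<times> nat) set \<Rightarrow> 'n gen" where
  "cell_gen C = Kos (\<lambda>i. C `` {i})"

text \<open>The differential of \<open>K_tilde\<close> after extension of scalars, with the images \<open>y\<close> of the variables in any commutative
  ring.\<close>

definition cell_bd :: "('n::{finite,linorder} \<times> nat \<Rightarrow> 'r::comm_ring_1) \<Rightarrow> 'n gen \<Rightarrow> ('n gen \<Rightarrow>\<^sub>0 'r)" where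
  "cell_bd y e = (case e of
       Aug \<Rightarrow> 0
     | Kos A \<Rightarrow>
         if \<forall>i. card (A i) = 1
         then Poly_Mapping.single Aug (\<Prod>i\<in>UNIV. y (i, the_elem (A i)))
         else \<Sum>i\<in>{i. card (A i) > 1}. \<Sum>b\<in>A i.
           Poly_Mapping.single (Kos (A(i := A i - {b}))) ((-1) ^ sigma_sign A i b * y (i, b)))"

definition cell_complex ::
  "('n::{finite,linorder} \<Rightarrow> nat) \<Rightarrow> ('n \<Rightarrow> nat) set \<Rightarrow> ('n \<times> nat \<Rightarrow> 'r::comm_ring_1) \<Rightarrow> ('n gen, 'r) free_complex" where
  "cell_complex d P y =
     \<lparr>gens = (\<lambda>k. case k of 0 \<Rightarrow> {Aug} | Suc k \<Rightarrow> cell_gen ` {C \<in> cells d P. card C = k + CARD('n)}),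
      bd = cell_bd y\<rparr>"

lemma gens_cell_complex:
  "gens (cell_complex d P y) 0 = {Aug}"
  "gens (cell_complex (d :: 'n::{finite,linorder} \<Rightarrow> nat) P y) (Suc k) = cell_gen ` {C \<in> cells d P. card C = k + CARD('n)}"
  by (simp_all add: cell_complex_def)

lemma bd_cell_complex: "bd (cell_complex d P y) = cell_bd y"
  by (simp add: cell_complex_def)

lemma cell_gen_eq_iff: "cell_gen C = cell_gen C' \<longleftrightarrow> C = C'"
  by (auto simp: cell_gen_def fun_eq_iff set_eq_iff)

lemma card_fibres: "finite C \<Longrightarrow> card C = (\<Sum>i\<in>UNIV. card (C `` {i}))" for C :: "('n::finite \<times> nat) set"
proof -
  assume "finite C"
  moreover have "C = (SIGMA i:UNIV. C `` {i})" by auto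
  ultimately show ?thesis using card_SigmaI[of UNIV "\<lambda>i. C `` {i}"] by (simp add: finite_fibre)
qed

lemma singleton_fibres_iff:
  fixes C :: "('n::finite \<times> nat) set"
  assumes "C \<subseteq> box d" "full C"
  shows "(\<forall>i. card (C `` {i}) = 1) \<longleftrightarrow> card C = CARD('n)"
proof
  assume "card C = CARD('n)"
  then have "C = graph (corner C)" by (rule full_card_graph[OF assms])
  moreover have "graph (corner C) `` {i} = {corner C i}" for i by (auto simp: graph_def)
  ultimately show "\<forall>i. card (C `` {i}) = 1" by (metis is_singletonI is_singleton_altdef)
qed (simp add: card_fibres[OF finite_subset_box[OF assms(1)]])

lemma sigma_sign_fibres:
  fixes C :: "('n::{finite,linorder} \<times> nat) set"
  assumes "finite C" "full C" "(i, b) \<in> C"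
  shows "sigma_sign (\<lambda>i. C `` {i}) i b + card {..<i} = card {c \<in> C - {(i, b)}. c < (i, b)}"
proof -
  have "{c \<in> C - {(i, b)}. c < (i, b)} = (SIGMA j:{..<i}. C `` {j}) \<union> {i} \<times> {c \<in> C `` {i}. c < b}"
    by (auto simp: order.order_iff_strict)
  moreover have "card \<dots> = (\<Sum>j\<in>{..<i}. card (C `` {j})) + card {c \<in> C `` {i}. c < b}"
    using assms(1) by (subst card_Un_disjoint) (auto simp: finite_fibre card_cartesian_product)
  moreover have "card (C `` {j}) = (card (C `` {j}) - 1) + 1" for j
    using assms(2) finite_fibre[OF assms(1), of j] by (simp add: full_def card_gt_0_iff)
  then have "(\<Sum>j\<in>{..<i}. card (C `` {j})) = (\<Sum>j\<in>{..<i}. card (C `` {j}) - 1) + card {..<i}"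
    by (metis (no_types, lifting) card_eq_sum sum.cong sum.distrib)
  ultimately show ?thesis by (simp add: sigma_sign_def)
qed

lemma fibres_remove:
  "(\<lambda>i. C `` {i})(i := C `` {i} - {b}) = (\<lambda>j. (C - {(i, b)}) `` {j})"
  by (auto simp: fun_eq_iff)

text \<open>The points whose removal leaves a full set are those in the rows with more than one point, so the two descriptions of the faces agree.\<close>

lemma cell_bd_eq:
  fixes C :: "('n::{finite,linorder} \<times> nat) set"
  assumes "C \<subseteq> box d" "full C" "card C \<noteq> CARD('n)"
  shows "cell_bd y (cell_gen C) = (\<Sum>p\<in>{p \<in> C. full (C - {p})}.
    Poly_Mapping.single (cell_gen (C - {p})) ((-1) ^ card {c \<in> C - {p}. c < p} * twist y p))"
proof -
  have fin: "finite C" using assms finite_subset_box by blast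
  have idx: "(SIGMA i:{i. card (C `` {i}) > 1}. C `` {i}) = {p \<in> C. full (C - {p})}"
  proof -
    have "card (C `` {i}) > 1 \<longleftrightarrow> full (C - {(i, b)})" if "(i, b) \<in> C" for i b
    proof -
      have "full (C - {(i, b)}) \<longleftrightarrow> (C - {(i, b)}) `` {i} \<noteq> {}"
        using assms(2) by (auto simp: full_def)
      also have "(C - {(i, b)}) `` {i} = C `` {i} - {b}" by auto
      also have "\<dots> \<noteq> {} \<longleftrightarrow> card (C `` {i} - {b}) > 0"
        using fin by (simp add: card_gt_0_iff finite_fibre)
      also have "\<dots> \<longleftrightarrow> card (C `` {i}) > 1"
        using that fin by (subst card_Diff_singleton) auto
      finally show ?thesis by simp
    qed
    then show ?thesis by auto
  qed
  have "cell_bd y (cell_gen C) = (\<Sum>i\<in>{i. card (C `` {i}) > 1}. \<Sum>b\<in>C `` {i}.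
      Poly_Mapping.single (cell_gen (C - {(i, b)})) ((-1) ^ sigma_sign (\<lambda>i. C `` {i}) i b * y (i, b)))"
    using singleton_fibres_iff[OF assms(1,2)] assms(3)
    by (simp only: cell_bd_def cell_gen_def gen.case fibres_remove if_False)
  also have "\<dots> = (\<Sum>(i, b)\<in>{p \<in> C. full (C - {p})}.
      Poly_Mapping.single (cell_gen (C - {(i, b)})) ((-1) ^ sigma_sign (\<lambda>i. C `` {i}) i b * y (i, b)))"
    unfolding idx[symmetric] using fin by (subst sum.Sigma) (auto simp: finite_fibre)
  also have "\<dots> = (\<Sum>p\<in>{p \<in> C. full (C - {p})}.
      Poly_Mapping.single (cell_gen (C - {p})) ((-1) ^ card {c \<in> C - {p}. c < p} * twist y p))"
  proof (rule sum.cong[OF refl], clarify)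
    fix i b assume ib: "(i, b) \<in> C"
    show "Poly_Mapping.single (cell_gen (C - {(i, b)})) ((-1) ^ sigma_sign (\<lambda>i. C `` {i}) i b * y (i, b)) =
        Poly_Mapping.single (cell_gen (C - {(i, b)})) ((-1) ^ card {c \<in> C - {(i, b)}. c < (i, b)} * twist y (i, b))"
      unfolding sigma_sign_fibres[OF fin assms(2) ib, symmetric]
      by (simp add: twist_def power_add mult.assoc neg_one_power_cancel)
  qed
  finally show ?thesis .
qed

lemma cell_bd_graph:
  "cell_bd y (cell_gen (graph a)) = Poly_Mapping.single Aug (\<Prod>i\<in>UNIV. y (i, a i))"
proof -
  have "graph a `` {i} = {a i}" for i by (auto simp: graph_def)
  then show ?thesis by (simp add: cell_bd_def cell_gen_def)
qed

lemma lookup_smult: "Poly_Mapping.lookup (smult r v) e = r * Poly_Mapping.lookup v e"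
  unfolding smult_def by (simp add: Poly_Mapping.map.rep_eq when_def)

lemma lookup_lin_ext:
  assumes "v \<in> free_mod G" "finite G"
  shows "Poly_Mapping.lookup (lin_ext g v) e' = (\<Sum>e\<in>G. Poly_Mapping.lookup v e * Poly_Mapping.lookup (g e) e')"
proof -
  have "Poly_Mapping.lookup (lin_ext g v) e' =
      (\<Sum>e\<in>Poly_Mapping.keys v. Poly_Mapping.lookup v e * Poly_Mapping.lookup (g e) e')"
    unfolding lin_ext_def by (simp add: lookup_sum lookup_smult)
  also have "\<dots> = (\<Sum>e\<in>G. Poly_Mapping.lookup v e * Poly_Mapping.lookup (g e) e')"
    using assms by (intro sum.mono_neutral_left) (auto simp: free_mod_def in_keys_iff)
  finally show ?thesis .
qed

lemma lookup_free_mod: "v \<in> free_mod G \<Longrightarrow> e \<notin> G \<Longrightarrow> Poly_Mapping.lookup v e = 0"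
  by (auto simp: free_mod_def in_keys_iff)

lemma free_modI: "(\<And>e. e \<notin> G \<Longrightarrow> Poly_Mapping.lookup v e = 0) \<Longrightarrow> v \<in> free_mod G"
  by (auto simp: free_mod_def in_keys_iff)

lemma lin_ext_in_free_mod:
  assumes "v \<in> free_mod G" "finite G" "\<And>e. e \<in> G \<Longrightarrow> g e \<in> free_mod H"
  shows "lin_ext g v \<in> free_mod H"
  by (rule free_modI) (simp add: lookup_lin_ext[OF assms(1,2)] lookup_free_mod[OF assms(3)])

lemma free_mod_exists:
  assumes "finite G"
  obtains v where "v \<in> free_mod G" "\<And>e. e \<in> G \<Longrightarrow> Poly_Mapping.lookup v e = h e"
proof
  let ?v = "\<Sum>e\<in>G. Poly_Mapping.single e (h e)"
  have l: "Poly_Mapping.lookup ?v e = (if e \<in> G then h e else 0)" for e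
    using assms by (simp add: lookup_sum lookup_single when_def)
  then show "?v \<in> free_mod G" by (intro free_modI) simp
  show "Poly_Mapping.lookup ?v e = h e" if "e \<in> G" for e using l that by simp
qed

lemma finite_gens_cell_complex: "finite (gens (cell_complex d P y) k)"
  by (cases k) (simp_all add: gens_cell_complex finite_cells)

lemma cell_gen_in_gens_iff:
  "cell_gen C \<in> gens (cell_complex (d :: 'n::{finite,linorder} \<Rightarrow> nat) P y) (Suc k) \<longleftrightarrow>
   C \<in> cells d P \<and> card C = k + CARD('n)"
  by (auto simp: gens_cell_complex cell_gen_eq_iff)

lemma full_card_ge: "full C \<Longrightarrow> finite C \<Longrightarrow> CARD('n) \<le> card C" for C :: "('n::finite \<times> nat) set"
proof -
  assume "full C" "finite C"
  have "fst ` C = UNIV" using \<open>full C\<close> by (force simp: full_def)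
  then show ?thesis using card_image_le[OF \<open>finite C\<close>, of fst] by simp
qed

lemma cell_bd_in_chain_mod:
  fixes d :: "'n::{finite,linorder} \<Rightarrow> nat"
  assumes "poset_ideal d P" "e \<in> gens (cell_complex d P y) (Suc k)"
  shows "cell_bd y e \<in> free_mod (gens (cell_complex d P y) k)"
proof -
  obtain C where C: "e = cell_gen C" "C \<in> cells d P" "card C = k + CARD('n)"
    using assms(2) by (auto simp: gens_cell_complex)
  then have Cb: "C \<subseteq> box d" "full C" by (auto simp: cells_def)
  have fin: "finite C" using Cb finite_subset_box by blast
  show ?thesis
  proof (cases k)
    case 0
    have "C = graph (corner C)" using full_card_graph[OF Cb] C 0 by simp
    then have "cell_bd y e = Poly_Mapping.single Aug (\<Prod>i\<in>UNIV. y (i, corner C i))"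
      using cell_bd_graph[of y "corner C"] C(1) by simp
    then show ?thesis by (simp add: free_mod_def gens_cell_complex 0)
  next
    case (Suc l)
    have mem: "cell_gen (C - {p}) \<in> gens (cell_complex d P y) k" if "p \<in> C" "full (C - {p})" for p
      using cells_downward_closed[OF assms(1) C(2), of "C - {p}"] that C(3) Suc fin
      by (simp add: cell_gen_in_gens_iff)
    show ?thesis
      unfolding C(1)
    proof (rule free_modI)
      fix e' assume "e' \<notin> gens (cell_complex d P y) k"
      then have "cell_gen (C - {p}) \<noteq> e'" if "p \<in> C" "full (C - {p})" for p
        using mem[OF that] by auto
      moreover have "card C \<noteq> CARD('n)" using C(3) Suc by simp
      ultimately show "Poly_Mapping.lookup (cell_bd y (cell_gen C)) e' = 0"
        by (simp add: cell_bd_eq[OF Cb] lookup_sum lookup_single)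
    qed
  qed
qed

text \<open>Passage from chains in the free module to coordinate functions.\<close>

lemma lookup_lin_ext_cell_bd:
  fixes d :: "'n::{finite,linorder} \<Rightarrow> nat"
  assumes v: "v \<in> free_mod (gens (cell_complex d P y) (Suc (Suc k)))"
    and C: "C \<subseteq> box d" "full C"
  shows "Poly_Mapping.lookup (lin_ext (cell_bd y) v) (cell_gen C) =
    face_sum d y (\<lambda>C. Poly_Mapping.lookup v (cell_gen C)) C"
proof -
  let ?G = "{C \<in> cells d P. card C = Suc k + CARD('n)}"
  let ?z = "\<lambda>C. Poly_Mapping.lookup v (cell_gen C)"
  let ?t = "\<lambda>p. (-1) ^ card {c \<in> C. c < p} * twist y p"
  have bd: "Poly_Mapping.lookup (cell_bd y (cell_gen C')) (cell_gen C) =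
      (\<Sum>p\<in>box d. if p \<notin> C \<and> C' = insert p C then ?t p else 0)" if C': "C' \<in> ?G" for C'
  proof -
    have C'b: "C' \<subseteq> box d" "full C'" "card C' \<noteq> CARD('n)" using C' by (auto simp: cells_def)
    have "Poly_Mapping.lookup (cell_bd y (cell_gen C')) (cell_gen C) =
      (\<Sum>p\<in>{p \<in> C'. full (C' - {p})}. if C' - {p} = C then (-1) ^ card {c \<in> C' - {p}. c < p} * twist y p else 0)"
      by (simp only: cell_bd_eq[OF C'b] lookup_sum lookup_single when_def cell_gen_eq_iff)
    also have "\<dots> = (\<Sum>p\<in>{p \<in> C'. full (C' - {p})}. if p \<notin> C \<and> C' = insert p C then ?t p else 0)"
      by (intro sum.cong refl) (auto simp: insert_absorb)
    also have "\<dots> = (\<Sum>p\<in>box d. if p \<notin> C \<and> C' = insert p C then ?t p else 0)"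
      using C'b(1) C(2) by (intro sum.mono_neutral_left) (auto simp: finite_box)
    finally show ?thesis .
  qed
  have fin: "finite ?G" by (simp add: finite_cells)
  have "Poly_Mapping.lookup (lin_ext (cell_bd y) v) (cell_gen C) =
      (\<Sum>e\<in>cell_gen ` ?G. Poly_Mapping.lookup v e * Poly_Mapping.lookup (cell_bd y e) (cell_gen C))"
    using lookup_lin_ext[OF v finite_gens_cell_complex] by (simp only: gens_cell_complex)
  also have "\<dots> = (\<Sum>C'\<in>?G. ?z C' * Poly_Mapping.lookup (cell_bd y (cell_gen C')) (cell_gen C))"
    by (subst sum.reindex) (simp_all add: inj_on_def cell_gen_eq_iff)
  also have "\<dots> = (\<Sum>C'\<in>?G. \<Sum>p\<in>box d. if p \<notin> C \<and> C' = insert p C then ?z C' * ?t p else 0)"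
    by (intro sum.cong refl) (simp only: bd sum_distrib_left if_distrib mult_zero_right)
  also have "\<dots> = (\<Sum>p\<in>box d. \<Sum>C'\<in>?G. if p \<notin> C \<and> C' = insert p C then ?z C' * ?t p else 0)"
    by (rule sum.swap)
  also have "\<dots> = (\<Sum>p\<in>box d. if p \<notin> C then ?z (insert p C) * ?t p else 0)"
  proof (rule sum.cong[OF refl])
    fix p
    have "?z (insert p C) = 0" if "insert p C \<notin> ?G"
      using that lookup_free_mod[OF v] cell_gen_in_gens_iff by blast
    then show "(\<Sum>C'\<in>?G. if p \<notin> C \<and> C' = insert p C then ?z C' * ?t p else 0) =
        (if p \<notin> C then ?z (insert p C) * ?t p else 0)"
      using fin by (cases "p \<in> C") (simp_all add: sum.delta)
  qed
  also have "\<dots> = face_sum d y ?z C"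
    unfolding face_sum_def koszul_diff_def
    by (simp add: sum.If_cases finite_box set_diff_eq Collect_conj_eq Int_commute mult.commute Compl_eq)
  finally show ?thesis .
qed

text \<open>The cells of degree 1 are the graphs of the elements of \<open>P\<close>.\<close>

lemma lookup_lin_ext_cell_bd_Aug:
  fixes d :: "'n::{finite,linorder} \<Rightarrow> nat"
  assumes "poset_ideal d P" "v \<in> free_mod (gens (cell_complex d P y) 1)"
  shows "Poly_Mapping.lookup (lin_ext (cell_bd y) v) Aug =
    (\<Sum>a\<in>P. Poly_Mapping.lookup v (cell_gen (graph a)) * (\<Prod>i\<in>UNIV. y (i, a i)))"
proof -
  have PD: "P \<subseteq> D_box d" using assms(1) by (simp add: poset_ideal_def)
  have "{C \<in> cells d P. card C = CARD('n)} = graph ` P"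
  proof
    show "{C \<in> cells d P. card C = CARD('n)} \<subseteq> graph ` P"
    proof
      fix C assume "C \<in> {C \<in> cells d P. card C = CARD('n)}"
      then have "C \<subseteq> box d" "full C" "card C = CARD('n)" "corner C \<in> P"
        by (simp_all add: cells_def)
      then show "C \<in> graph ` P" using full_card_graph by blast
    qed
    show "graph ` P \<subseteq> {C \<in> cells d P. card C = CARD('n)}"
      using PD graph_in_cells card_graph by blast
  qed
  then have gens: "gens (cell_complex d P y) 1 = (\<lambda>a. cell_gen (graph a)) ` P"
    using gens_cell_complex(2)[of d P y 0] by (simp add: image_image)
  have "inj_on (\<lambda>a. cell_gen (graph a)) P"
    by (rule inj_onI) (metis cell_gen_eq_iff corner_graph)
  then show ?thesis
    unfolding lookup_lin_ext[OF assms(2) finite_gens_cell_complex] gens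
    by (simp add: sum.reindex cell_bd_graph)
qed

section \<open>The complex as a free resolution\<close>

lemma ideal_gen_eq_lin_combs:
  fixes f :: "'p \<Rightarrow> 'r::comm_ring_1"
  assumes "finite A"
  shows "ideal_gen (f ` A) = lin_combs f A"
proof -
  interpret m: module "(*) :: 'r \<Rightarrow> 'r \<Rightarrow> 'r" by unfold_locales (simp_all add: algebra_simps)
  have "m.span (f ` A) \<subseteq> lin_combs f A"
  proof (intro m.span_minimal m.subspaceI)
    show "c * g \<in> lin_combs f A" if "g \<in> lin_combs f A" for c g
      using lin_combs_mult[OF that, of c] by (simp add: mult.commute)
  qed (use assms in \<open>auto simp: lin_combs_generator lin_combs_0 lin_combs_add\<close>)
  moreover have "lin_combs f A \<subseteq> m.span (f ` A)"
  proof
    fix g assume "g \<in> lin_combs f A"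
    then obtain c where "g = (\<Sum>p\<in>A. f p * c p)" by (rule lin_combsE)
    then have "g = (\<Sum>p\<in>A. c p * f p)" by (simp add: mult.commute)
    then show "g \<in> m.span (f ` A)"
      by (simp add: m.span_sum m.span_scale m.span_base)
  qed
  ultimately show ?thesis by (auto simp: ideal_gen_def)
qed

lemma augmentation_coset:
  fixes J :: "'r::comm_ring_1 set"
  assumes J: "0 \<in> J" "\<And>g h. g \<in> J \<Longrightarrow> h \<in> J \<Longrightarrow> g + h \<in> J" "\<And>g h. g \<in> J \<Longrightarrow> g * h \<in> J"
  shows "augmentation {e} J (\<lambda>v. Poly_Mapping.lookup v e +o J)"
  unfolding augmentation_def
proof (intro conjI ballI allI)
  show "(\<lambda>v. Poly_Mapping.lookup v e +o J) ` free_mod {e} = {r +o J |r. True}"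
  proof
    show "{r +o J |r. True} \<subseteq> (\<lambda>v. Poly_Mapping.lookup v e +o J) ` free_mod {e}"
    proof clarify
      fix r
      show "r +o J \<in> (\<lambda>v. Poly_Mapping.lookup v e +o J) ` free_mod {e}"
        by (rule image_eqI[of _ _ "Poly_Mapping.single e r"]) (simp_all add: free_mod_def)
    qed
  qed auto
  have coset_add: "(r + s) +o J = (r +o J) + (s +o J)" for r s
  proof
    show "(r + s) +o J \<subseteq> (r +o J) + (s +o J)"
    proof
      fix t assume "t \<in> (r + s) +o J"
      then obtain j where "j \<in> J" "t = (r + j) + (s + 0)" by (auto simp: elt_set_plus_def add_ac)
      then show "t \<in> (r +o J) + (s +o J)" using J(1) unfolding set_plus_def elt_set_plus_def by blast
    qed
    show "(r +o J) + (s +o J) \<subseteq> (r + s) +o J"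
    proof
      fix t assume "t \<in> (r +o J) + (s +o J)"
      then obtain j j' where "j \<in> J" "j' \<in> J" "t = (r + s) + (j + j')"
        by (auto simp: set_plus_def elt_set_plus_def add_ac)
      then show "t \<in> (r + s) +o J" using J(2) unfolding elt_set_plus_def by blast
    qed
  qed
  show "Poly_Mapping.lookup (u + v) e +o J = (Poly_Mapping.lookup u e +o J) + (Poly_Mapping.lookup v e +o J)" for u v
    by (simp add: lookup_add coset_add)
  have coset_mult: "(r * s) +o J = r *o (s +o J) + J" for r s
  proof
    show "(r * s) +o J \<subseteq> r *o (s +o J) + J"
    proof
      fix t assume "t \<in> (r * s) +o J"
      then obtain j where "j \<in> J" "t = r * (s + 0) + j" by (auto simp: elt_set_plus_def)
      then show "t \<in> r *o (s +o J) + J"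
        using J(1) unfolding set_plus_def elt_set_plus_def elt_set_times_def by blast
    qed
    show "r *o (s +o J) + J \<subseteq> (r * s) +o J"
    proof
      fix t assume "t \<in> r *o (s +o J) + J"
      then obtain j j' where "j \<in> J" "j' \<in> J" "t = r * s + (j * r + j')"
        by (auto simp: set_plus_def elt_set_plus_def elt_set_times_def algebra_simps)
      then show "t \<in> (r * s) +o J" using J(2,3) unfolding elt_set_plus_def by blast
    qed
  qed
  show "Poly_Mapping.lookup (smult r v) e +o J = r *o (Poly_Mapping.lookup v e +o J) + J" for r v
    by (simp add: lookup_smult coset_mult)
qed

lemma coset_eq_iff:
  fixes J :: "'r::comm_ring_1 set"
  assumes J: "0 \<in> J" "\<And>g h. g \<in> J \<Longrightarrow> h \<in> J \<Longrightarrow> g + h \<in> J" "\<And>g h. g \<in> J \<Longrightarrow> g * h \<in> J"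
  shows "r +o J = J \<longleftrightarrow> r \<in> J"
proof
  assume "r +o J = J"
  then show "r \<in> J" using set_plus_intro2[OF J(1), of r] by simp
next
  assume r: "r \<in> J"
  show "r +o J = J"
  proof
    show "r +o J \<subseteq> J" using J(2)[OF r] by (auto simp: elt_set_plus_def)
    show "J \<subseteq> r +o J"
    proof
      fix t assume "t \<in> J"
      then have "r * (-1) + t \<in> J" using J r by blast
      then show "t \<in> r +o J" unfolding elt_set_plus_def by (intro CollectI bexI[of _ "r * (-1) + t"]) simp_all
    qed
  qed
qed

text \<open>The exactness of \<open>face_sum_exact\<close> in terms of the free modules. The augmentation sends the basis
  element of degree 0 to the coset of 1.\<close>

theorem free_resolution_cell_complex:
  fixes d :: "'n::{finite,linorder} \<Rightarrow> nat" and y :: "'n \<times> nat \<Rightarrow> 'r::comm_ring_1"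
  assumes ideal: "poset_ideal d P"
    and regular: "\<And>a J p. a \<in> P \<Longrightarrow> J \<subseteq> below a \<Longrightarrow> p \<in> below a - J \<Longrightarrow> nzd_mod y J (y p)"
    and corner_regular: "\<And>a i. a \<in> P \<Longrightarrow> nzd_mod y (below a) (y (i, a i))"
  defines "F \<equiv> cell_complex d P y" and "J \<equiv> ideal_gen ((\<lambda>a. \<Prod>i\<in>UNIV. y (i, a i)) ` P)"
  shows "free_resolution F J (\<lambda>v. Poly_Mapping.lookup v Aug +o J)"
proof -
  let ?Y = "\<lambda>a. \<Prod>i\<in>UNIV. y (i, a i)"
  let ?L = "lin_ext (cell_bd y)"
  have PD: "P \<subseteq> D_box d" using ideal by (simp add: poset_ideal_def)
  then have finP: "finite P" using finite_D_box finite_subset by blast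
  have J: "J = lin_combs ?Y P" unfolding J_def by (rule ideal_gen_eq_lin_combs[OF finP])
  have fin: "finite (gens F k)" for k by (simp add: F_def finite_gens_cell_complex)
  have bd: "bd F = cell_bd y" by (simp add: F_def bd_cell_complex)
  have bd_mem: "cell_bd y e \<in> chain_mod F k" if "e \<in> gens F (Suc k)" for e k
    using cell_bd_in_chain_mod[OF ideal, of e y k] that by (simp add: F_def chain_mod_def)
  have L_mem: "?L v \<in> chain_mod F k" if "v \<in> chain_mod F (Suc k)" for v k
    using lin_ext_in_free_mod[of v "gens F (Suc k)" "cell_bd y" "gens F k"] that fin bd_mem
    by (simp add: chain_mod_def)
  have L_Aug: "Poly_Mapping.lookup (?L v) Aug = (\<Sum>a\<in>P. Poly_Mapping.lookup v (cell_gen (graph a)) * ?Y a)"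
    if "v \<in> chain_mod F 1" for v
    using lookup_lin_ext_cell_bd_Aug[OF ideal] that by (simp add: F_def chain_mod_def)
  have L_cell: "Poly_Mapping.lookup (?L v) (cell_gen C) =
      face_sum d y (\<lambda>C. Poly_Mapping.lookup v (cell_gen C)) C"
    if "v \<in> chain_mod F (Suc (Suc k))" "C \<subseteq> box d" "full C" for v k C
    using lookup_lin_ext_cell_bd that by (auto simp: F_def chain_mod_def)
  have supp: "Poly_Mapping.lookup v (cell_gen C) = 0"
    if "v \<in> chain_mod F (Suc k)" "\<not> (C \<in> cells d P \<and> card C = k + CARD('n))" for v k C
    using that lookup_free_mod[of v "gens F (Suc k)" "cell_gen C"] cell_gen_in_gens_iff[of C d P y k]
    by (auto simp: F_def chain_mod_def)
  have chain_eqI: "u = v"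
    if "u \<in> chain_mod F (Suc k)" "v \<in> chain_mod F (Suc k)"
      "\<And>C. C \<in> cells d P \<Longrightarrow> card C = k + CARD('n) \<Longrightarrow>
        Poly_Mapping.lookup u (cell_gen C) = Poly_Mapping.lookup v (cell_gen C)" for u v k
  proof (rule poly_mapping_eqI)
    fix e
    show "Poly_Mapping.lookup u e = Poly_Mapping.lookup v e"
    proof (cases "e \<in> gens F (Suc k)")
      case True
      then show ?thesis using that(3) by (auto simp: F_def gens_cell_complex)
    next
      case False
      then show ?thesis using that(1,2) by (simp add: chain_mod_def lookup_free_mod)
    qed
  qed
  have chain_0_eqI: "u = v"
    if "u \<in> chain_mod F 0" "v \<in> chain_mod F 0" "Poly_Mapping.lookup u Aug = Poly_Mapping.lookup v Aug" for u v
  proof (rule poly_mapping_eqI)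
    fix e
    show "Poly_Mapping.lookup u e = Poly_Mapping.lookup v e"
      using that by (cases "e = Aug") (auto simp: F_def chain_mod_def gens_cell_complex lookup_free_mod)
  qed
  have zero_mem: "0 \<in> chain_mod F k" for k by (simp add: chain_mod_def free_mod_def)

  have image_0: "?L ` chain_mod F 1 = {v \<in> chain_mod F 0. Poly_Mapping.lookup v Aug \<in> J}"
  proof (intro equalityI subsetI)
    fix u assume "u \<in> ?L ` chain_mod F 1"
    then show "u \<in> {v \<in> chain_mod F 0. Poly_Mapping.lookup v Aug \<in> J}"
      using L_mem[of _ 0] unfolding J
      by (auto simp: L_Aug mult.commute[of _ "?Y _"] intro: lin_combsI)
  next
    fix u assume u: "u \<in> {v \<in> chain_mod F 0. Poly_Mapping.lookup v Aug \<in> J}"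
    then obtain c where c: "Poly_Mapping.lookup u Aug = (\<Sum>a\<in>P. ?Y a * c a)"
      unfolding J by (auto elim: lin_combsE)
    obtain v where v: "v \<in> free_mod (gens F 1)"
      "\<And>e. e \<in> gens F 1 \<Longrightarrow> Poly_Mapping.lookup v e = (case e of Aug \<Rightarrow> 0 | Kos A \<Rightarrow> c (\<lambda>i. the_elem (A i)))"
      using free_mod_exists[OF fin[of 1], of "\<lambda>e. case e of Aug \<Rightarrow> 0 | Kos A \<Rightarrow> c (\<lambda>i. the_elem (A i))"]
      by blast
    have "Poly_Mapping.lookup v (cell_gen (graph a)) = c a" if a: "a \<in> P" for a
    proof -
      have "graph a \<in> cells d P" using graph_in_cells a PD by blast
      then have "cell_gen (graph a) \<in> gens F 1"
        using cell_gen_in_gens_iff[of "graph a" d P y 0] by (simp add: F_def card_graph)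
      moreover have "graph a `` {i} = {a i}" for i by (auto simp: graph_def)
      ultimately show ?thesis using v(2) by (simp add: cell_gen_def)
    qed
    then have "Poly_Mapping.lookup (?L v) Aug = Poly_Mapping.lookup u Aug"
      using L_Aug v(1) c by (simp add: chain_mod_def mult.commute)
    moreover have "v \<in> chain_mod F 1" using v(1) by (simp add: chain_mod_def)
    ultimately have "?L v = u" using u L_mem[of v 0] by (intro chain_0_eqI) simp_all
    then show "u \<in> ?L ` chain_mod F 1" using \<open>v \<in> chain_mod F 1\<close> by blast
  qed

  have square: "?L (?L v) = 0" if v: "v \<in> chain_mod F (Suc (Suc k))" for v k
  proof (cases k)
    case 0
    have "Poly_Mapping.lookup (?L (?L v)) Aug = (\<Sum>a\<in>P. Poly_Mapping.lookup (?L v) (cell_gen (graph a)) * ?Y a)"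
      using L_mem[OF v] 0 by (intro L_Aug) simp
    also have "\<dots> = (\<Sum>a\<in>P. face_sum d y (\<lambda>C. Poly_Mapping.lookup v (cell_gen C)) (graph a) * ?Y a)"
      using PD by (intro sum.cong refl) (auto simp: L_cell[OF v] graph_subset_box full_graph)
    also have "\<dots> = 0" using supp[OF v] by (intro augmentation_face_sum[OF ideal]) blast
    finally show ?thesis using L_mem[OF L_mem[OF v, unfolded 0]] zero_mem by (intro chain_0_eqI) simp_all
  next
    case (Suc l)
    show ?thesis
    proof (rule chain_eqI[of _ l])
      fix C assume "C \<in> cells d P"
      then have C: "C \<subseteq> box d" "full C" by (auto simp: cells_def)
      have "Poly_Mapping.lookup (?L (?L v)) (cell_gen C) =
          face_sum d y (\<lambda>C. Poly_Mapping.lookup (?L v) (cell_gen C)) C"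
        using L_mem[OF v] Suc C by (intro L_cell[of _ l]) simp_all
      also have "\<dots> = face_sum d y (face_sum d y (\<lambda>C. Poly_Mapping.lookup v (cell_gen C))) C"
        using C by (intro face_sum_cong L_cell[OF v] full_mono[OF C(2) subset_insertI]) auto
      finally show "Poly_Mapping.lookup (?L (?L v)) (cell_gen C) = Poly_Mapping.lookup 0 (cell_gen C)"
        by (simp add: face_sum_face_sum[OF C(1)])
    qed (use L_mem[OF L_mem[OF v, unfolded Suc]] zero_mem in simp_all)
  qed

  have exact: "u \<in> ?L ` chain_mod F (Suc (Suc k))" if u: "u \<in> chain_mod F (Suc k)" "?L u = 0" for u k
  proof -
    let ?z = "\<lambda>C. Poly_Mapping.lookup u (cell_gen C)"
    have "\<exists>w. (\<forall>C. C \<notin> cells d P \<longrightarrow> w C = 0) \<and>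
      (\<forall>C. C \<subseteq> box d \<longrightarrow> full C \<longrightarrow> card C = k + CARD('n) \<longrightarrow> ?z C = face_sum d y w C)"
    proof (rule face_sum_exact[OF ideal regular corner_regular])
      fix C assume "C \<notin> cells d P"
      then show "?z C = 0" using supp[OF u(1)] by blast
    next
      fix C assume C: "C \<subseteq> box d" "full C" "Suc (card C) = k + CARD('n)"
      then have "CARD('n) \<le> card C" by (intro full_card_ge finite_subset_box)
      then obtain l where "k = Suc l" using C(3) by (cases k) auto
      then show "face_sum d y ?z C = 0" using L_cell[of u l C] u C by simp
    next
      assume "k = 0"
      then show "(\<Sum>a\<in>P. ?z (graph a) * ?Y a) = 0" using L_Aug[of u] u by simp
    qed
    then obtain w where w: "\<And>C. C \<notin> cells d P \<Longrightarrow> w C = 0"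
      "\<And>C. C \<subseteq> box d \<Longrightarrow> full C \<Longrightarrow> card C = k + CARD('n) \<Longrightarrow> ?z C = face_sum d y w C" by blast
    let ?h = "\<lambda>e. case e of Aug \<Rightarrow> 0 | Kos A \<Rightarrow> w (SIGMA i:UNIV. A i)"
    obtain v where v: "v \<in> free_mod (gens F (Suc (Suc k)))"
      "\<And>e. e \<in> gens F (Suc (Suc k)) \<Longrightarrow> Poly_Mapping.lookup v e = ?h e"
      using free_mod_exists[OF fin[of "Suc (Suc k)"], of ?h] by blast
    have v_mem: "v \<in> chain_mod F (Suc (Suc k))" using v(1) by (simp add: chain_mod_def)
    have v_w: "Poly_Mapping.lookup v (cell_gen C) = w C" if "card C = Suc k + CARD('n)" for C
    proof (cases "C \<in> cells d P")
      case True
      then have "cell_gen C \<in> gens F (Suc (Suc k))" using that by (simp add: F_def cell_gen_in_gens_iff)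
      moreover have "(SIGMA i:UNIV. C `` {i}) = C" by auto
      ultimately show ?thesis using v(2) by (simp add: cell_gen_def)
    next
      case False
      then show ?thesis using supp[OF v_mem] w(1) by simp
    qed
    \<comment> \<open>Chains in positive degree are determined by their coordinates on cells.\<close>
    have "?L v = u"
    proof (rule chain_eqI[of _ k])
      fix C assume C: "C \<in> cells d P" "card C = k + CARD('n)"
      then have Cb: "C \<subseteq> box d" "full C" by (auto simp: cells_def)
      have "Poly_Mapping.lookup (?L v) (cell_gen C) = face_sum d y (\<lambda>C. Poly_Mapping.lookup v (cell_gen C)) C"
        by (rule L_cell[OF v_mem Cb])
      also have "\<dots> = face_sum d y w C"
        using C(2) finite_subset_box[OF Cb(1)] by (intro face_sum_cong v_w) simp
      finally show "Poly_Mapping.lookup (?L v) (cell_gen C) = Poly_Mapping.lookup u (cell_gen C)"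
        using w(2)[OF Cb C(2)] by simp
    qed (use L_mem[OF v_mem] u in simp_all)
    then show ?thesis using v_mem by blast
  qed

  have J_ideal: "0 \<in> J" "\<And>g h. g \<in> J \<Longrightarrow> h \<in> J \<Longrightarrow> g + h \<in> J" "\<And>g h. g \<in> J \<Longrightarrow> g * h \<in> J"
    unfolding J by (simp_all add: lin_combs_0 lin_combs_add lin_combs_mult)
  show ?thesis
    unfolding free_resolution_def bd
  proof (intro conjI allI ballI)
    show "augmentation (gens F 0) J (\<lambda>v. Poly_Mapping.lookup v Aug +o J)"
      using augmentation_coset[OF J_ideal] by (simp add: F_def gens_cell_complex)
    show "{v \<in> chain_mod F 0. Poly_Mapping.lookup v Aug +o J = J} = ?L ` chain_mod F 1"
      using coset_eq_iff[OF J_ideal] image_0 by simp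
    show "{v \<in> chain_mod F (Suc k). ?L v = 0} = ?L ` chain_mod F (Suc (Suc k))" for k
      using exact[of _ k] square[of _ k] L_mem[of _ "Suc k"] by blast
  qed (use fin bd_mem in auto)
qed

section \<open>Substitution and grading in polynomial rings\<close>

lemma poly_mapping_eq_sum_single:
  "p = (\<Sum>m\<in>Poly_Mapping.keys p. Poly_Mapping.single m (Poly_Mapping.lookup p m))"
  by (rule poly_mapping_eqI) (simp add: lookup_sum lookup_single when_def in_keys_iff)

lemma const_0: "const 0 = 0" and const_1: "const 1 = 1"
  by (simp_all add: const_def)

lemma const_add: "const (a + b) = const a + const b"
  by (simp add: const_def single_add)

lemma const_mult: "const (a * b) = const a * const b"
  by (simp add: const_def mult_single)

definition monomial_value :: "('x \<Rightarrow> 'r::comm_ring_1) \<Rightarrow> ('x \<Rightarrow>\<^sub>0 nat) \<Rightarrow> 'r" where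
  "monomial_value g m = (\<Prod>x\<in>Poly_Mapping.keys m. g x ^ Poly_Mapping.lookup m x)"

lemma monomial_value_superset:
  assumes "finite X" "Poly_Mapping.keys m \<subseteq> X"
  shows "monomial_value g m = (\<Prod>x\<in>X. g x ^ Poly_Mapping.lookup m x)"
  unfolding monomial_value_def using assms
  by (intro prod.mono_neutral_left) (auto simp: in_keys_iff)

lemma monomial_value_add: "monomial_value g (m + m') = monomial_value g m * monomial_value g m'"
proof -
  let ?X = "Poly_Mapping.keys m \<union> Poly_Mapping.keys m'"
  have "monomial_value g (m + m') = (\<Prod>x\<in>?X. g x ^ Poly_Mapping.lookup (m + m') x)"
    by (intro monomial_value_superset keys_add) simp
  then show ?thesis
    by (simp add: monomial_value_superset[of ?X] lookup_add power_add prod.distrib)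
qed

lemma subst_hom_superset:
  assumes "finite M" "Poly_Mapping.keys p \<subseteq> M"
  shows "subst_hom g p = (\<Sum>m\<in>M. const (Poly_Mapping.lookup p m) * monomial_value g m)"
  unfolding subst_hom_def monomial_value_def using assms
  by (intro sum.mono_neutral_left) (auto simp: in_keys_iff const_0)

lemma subst_hom_add: "subst_hom g (p + q) = subst_hom g p + subst_hom g q"
proof -
  let ?M = "Poly_Mapping.keys p \<union> Poly_Mapping.keys q"
  have "subst_hom g (p + q) = (\<Sum>m\<in>?M. const (Poly_Mapping.lookup (p + q) m) * monomial_value g m)"
    by (intro subst_hom_superset keys_add) simp
  then show ?thesis
    by (simp add: subst_hom_superset[of ?M] lookup_add const_add distrib_right sum.distrib)
qed

lemma subst_hom_0: "subst_hom g 0 = 0"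
  by (simp add: subst_hom_def)

lemma subst_hom_sum: "subst_hom g (sum h A) = (\<Sum>a\<in>A. subst_hom g (h a))"
  by (induction A rule: infinite_finite_induct) (simp_all add: subst_hom_0 subst_hom_add)

lemma subst_hom_single: "subst_hom g (Poly_Mapping.single m c) = const c * monomial_value g m"
  by (subst subst_hom_superset[of "{m}"]) simp_all

lemma subst_hom_mult: "subst_hom g (p * q) = subst_hom g p * subst_hom g q"
proof -
  let ?s = "\<lambda>p m. Poly_Mapping.single m (Poly_Mapping.lookup p m)"
  have "subst_hom g (p * q) =
      subst_hom g ((\<Sum>m\<in>Poly_Mapping.keys p. ?s p m) * (\<Sum>m\<in>Poly_Mapping.keys q. ?s q m))"
    by (simp flip: poly_mapping_eq_sum_single)
  also have "\<dots> = (\<Sum>m\<in>Poly_Mapping.keys p. \<Sum>m'\<in>Poly_Mapping.keys q.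
      subst_hom g (?s p m) * subst_hom g (?s q m'))"
    by (simp add: sum_product subst_hom_sum mult_single subst_hom_single monomial_value_add
        const_mult mult_ac)
  also have "\<dots> = subst_hom g (\<Sum>m\<in>Poly_Mapping.keys p. ?s p m) * subst_hom g (\<Sum>m\<in>Poly_Mapping.keys q. ?s q m)"
    by (simp add: sum_product subst_hom_sum)
  also have "\<dots> = subst_hom g p * subst_hom g q"
    by (simp flip: poly_mapping_eq_sum_single)
  finally show ?thesis .
qed

lemma subst_hom_const: "subst_hom g (const c) = const c"
  using subst_hom_single[of g 0 c] by (simp add: monomial_value_def const_def)

lemma subst_hom_1: "subst_hom g 1 = 1"
  using subst_hom_const[of g 1] by (simp add: const_1)

lemma subst_hom_var: "subst_hom g (var x) = g x"
  by (simp add: var_def subst_hom_single monomial_value_def const_1)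

lemma subst_hom_uminus: "subst_hom g (- p) = - subst_hom g p"
  using subst_hom_add[of g p "- p"] by (simp add: subst_hom_0 eq_neg_iff_add_eq_0 add.commute)

lemma subst_hom_power: "subst_hom g (p ^ k) = subst_hom g p ^ k"
  by (induction k) (simp_all add: subst_hom_1 subst_hom_mult)

lemma subst_hom_prod: "subst_hom g (prod h A) = (\<Prod>a\<in>A. subst_hom g (h a))"
  by (induction A rule: infinite_finite_induct) (simp_all add: subst_hom_1 subst_hom_mult)

lemma var_power: "var x ^ k = Poly_Mapping.single (Poly_Mapping.single x k) 1"
  by (induction k) (simp_all add: var_def mult_single flip: single_add)

text \<open>The polynomial ring is generated as a ring by the constants and the variables.\<close>

lemma mpoly_induct [case_names const var add mult]:
  fixes p :: "('x, 'k::comm_ring_1) mpoly"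
  assumes const: "\<And>c. Q (const c)" and var: "\<And>x. Q (var x)"
    and add: "\<And>p q. Q p \<Longrightarrow> Q q \<Longrightarrow> Q (p + q)" and mult: "\<And>p q. Q p \<Longrightarrow> Q q \<Longrightarrow> Q (p * q)"
  shows "Q p"
proof -
  have Q_power: "Q (q ^ k)" if "Q q" for q :: "('x, 'k) mpoly" and k
    by (induction k) (use that mult const[of 1] in \<open>simp_all add: const_1\<close>)
  have Q_monomial: "Q (Poly_Mapping.single m c)" for m :: "'x \<Rightarrow>\<^sub>0 nat" and c :: 'k
  proof -
    have single_prod: "(\<Prod>x\<in>X. Poly_Mapping.single (h x) 1) = Poly_Mapping.single (sum h X) (1 :: 'k)"
      for X and h :: "'x \<Rightarrow> 'x \<Rightarrow>\<^sub>0 nat"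
      by (induction X rule: infinite_finite_induct) (simp_all add: mult_single)
    have "Q (\<Prod>x\<in>X. var x ^ Poly_Mapping.lookup m x)" for X
      by (induction X rule: infinite_finite_induct)
        (use const[of 1] mult Q_power[OF var] in \<open>simp_all add: const_1\<close>)
    moreover have "(\<Prod>x\<in>Poly_Mapping.keys m. var x ^ Poly_Mapping.lookup m x) = Poly_Mapping.single m (1 :: 'k)"
      unfolding var_power single_prod by (simp flip: poly_mapping_eq_sum_single)
    ultimately have "Q (const c * Poly_Mapping.single m 1)" using mult const by metis
    then show ?thesis by (simp add: const_def mult_single)
  qed
  have "Q (\<Sum>m\<in>M. Poly_Mapping.single m (Poly_Mapping.lookup p m))" for M
    by (induction M rule: infinite_finite_induct) (use const[of 0] add Q_monomial in \<open>simp_all add: const_0\<close>)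
  from this[of "Poly_Mapping.keys p"] show ?thesis by (simp flip: poly_mapping_eq_sum_single)
qed

lemma mdeg_superset:
  "finite X \<Longrightarrow> Poly_Mapping.keys m \<subseteq> X \<Longrightarrow> mdeg m = (\<Sum>x\<in>X. Poly_Mapping.lookup m x)"
  unfolding mdeg_def by (intro sum.mono_neutral_left) (auto simp: in_keys_iff)

lemma mdeg_add: "mdeg (m + m') = mdeg m + mdeg m'"
proof -
  let ?X = "Poly_Mapping.keys m \<union> Poly_Mapping.keys m'"
  have "mdeg (m + m') = (\<Sum>x\<in>?X. Poly_Mapping.lookup (m + m') x)"
    by (intro mdeg_superset keys_add) simp
  then show ?thesis by (simp add: mdeg_superset[of ?X] lookup_add sum.distrib)
qed

lemma homogeneous_0: "homogeneous k 0"
  by (simp add: homogeneous_def)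

lemma homogeneous_const: "homogeneous 0 (const c)"
  by (simp add: homogeneous_def const_def mdeg_def)

lemma homogeneous_1: "homogeneous 0 1"
  using homogeneous_const[of 1] by (simp add: const_1)

lemma homogeneous_var: "homogeneous 1 (var x)"
  by (simp add: homogeneous_def var_def mdeg_def)

lemma homogeneous_add: "homogeneous k p \<Longrightarrow> homogeneous k q \<Longrightarrow> homogeneous k (p + q)"
  unfolding homogeneous_def using keys_add[of p q] by blast

lemma homogeneous_sum: "(\<And>a. a \<in> A \<Longrightarrow> homogeneous k (h a)) \<Longrightarrow> homogeneous k (sum h A)"
  by (induction A rule: infinite_finite_induct) (simp_all add: homogeneous_0 homogeneous_add)

lemma homogeneous_mult:
  assumes "homogeneous k p" "homogeneous l q"
  shows "homogeneous (k + l) (p * q)"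
  unfolding homogeneous_def
proof
  fix m assume "m \<in> Poly_Mapping.keys (p * q)"
  then obtain a b where "a \<in> Poly_Mapping.keys p" "b \<in> Poly_Mapping.keys q" "m = a + b"
    using keys_mult[of p q] by blast
  then show "mdeg m = k + l" using assms by (simp add: homogeneous_def mdeg_add)
qed

lemma homogeneous_prod:
  "(\<And>a. a \<in> A \<Longrightarrow> homogeneous 1 (h a)) \<Longrightarrow> homogeneous (card A) (prod h A)"
proof (induction A rule: infinite_finite_induct)
  case (insert a A)
  then have "homogeneous (1 + card A) (h a * prod h A)" by (intro homogeneous_mult) simp_all
  then show ?case using insert.hyps by simp
qed (simp_all add: homogeneous_1)

lemma homogeneous_neg_one_power_mult: "homogeneous k p \<Longrightarrow> homogeneous k ((-1) ^ s * p)"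
proof (induction s)
  case (Suc s)
  then show ?case
    by (auto simp: homogeneous_def)
qed simp

lemma homogeneous_irrelevant: "homogeneous k p \<Longrightarrow> k > 0 \<Longrightarrow> p \<in> irrelevant_ideal"
  by (simp add: homogeneous_def irrelevant_ideal_def)

text \<open>A ring homomorphism commutes with the sums, signs and products in the differential, and families with
  nonempty members correspond to full sets via their sets of pairs.\<close>

lemma base_change_K_tilde:
  fixes d :: "'n::{finite,linorder} \<Rightarrow> nat"
    and g :: "'n \<times> nat \<Rightarrow> ('y, 'k::field) mpoly"
  shows "base_change (subst_hom g) (K_tilde d P) = cell_complex d P g"
proof -
  have "Poly_Mapping.lookup (Poly_Mapping.map (subst_hom g) v) e = subst_hom g (Poly_Mapping.lookup v e)"
    for v :: "'n gen \<Rightarrow>\<^sub>0 ('n \<times> nat, 'k) mpoly" and e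
    by (simp add: Poly_Mapping.map.rep_eq when_def subst_hom_0)
  then have "Poly_Mapping.map (subst_hom g) (bd (K_tilde d P) e) = cell_bd g e" for e
    by (intro poly_mapping_eqI)
      (cases e, auto simp: K_tilde_def cell_bd_def koszul_bd_def when_def
        lookup_sum lookup_single subst_hom_sum subst_hom_mult subst_hom_power subst_hom_prod
        subst_hom_uminus subst_hom_1 subst_hom_var subst_hom_0 if_distrib cong: if_cong)
  moreover have "gens (K_tilde d P :: ('n gen, ('n \<times> nat, 'k) mpoly) free_complex) k = gens (cell_complex d P g) k" for k
  proof (cases k)
    case 0
    then show ?thesis by (simp add: K_tilde_def gens_cell_complex)
  next
    case (Suc l)
    have "{Kos A |A. (\<forall>i. A i \<noteq> {} \<and> A i \<subseteq> {1..d i}) \<and> (\<lambda>i. Max (A i)) \<in> P \<and>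
        (\<Sum>i\<in>UNIV. card (A i)) = l + CARD('n)} = cell_gen ` {C \<in> cells d P. card C = l + CARD('n)}"
    proof (intro equalityI subsetI)
      fix e assume "e \<in> {Kos A |A. (\<forall>i. A i \<noteq> {} \<and> A i \<subseteq> {1..d i}) \<and> (\<lambda>i. Max (A i)) \<in> P \<and>
        (\<Sum>i\<in>UNIV. card (A i)) = l + CARD('n)}"
      then obtain A where A: "e = Kos A" "\<And>i. A i \<noteq> {} \<and> A i \<subseteq> {1..d i}" "(\<lambda>i. Max (A i)) \<in> P"
        "(\<Sum>i\<in>UNIV. card (A i)) = l + CARD('n)" by blast
      let ?C = "SIGMA i:UNIV. A i"
      have fib: "?C `` {i} = A i" for i by auto
      have "?C \<subseteq> box d" using A(2) by (auto simp: box_def)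
      moreover have "full ?C" using A(2) by (simp add: full_def fib)
      moreover have "corner ?C = (\<lambda>i. Max (A i))" by (simp add: corner_def fib fun_eq_iff)
      moreover have "card ?C = l + CARD('n)"
        using card_fibres[OF finite_subset_box[OF \<open>?C \<subseteq> box d\<close>]] A(4) by (simp only: fib)
      moreover have "e = cell_gen ?C" by (simp add: cell_gen_def fib A(1))
      ultimately show "e \<in> cell_gen ` {C \<in> cells d P. card C = l + CARD('n)}"
        using A(3) by (auto simp: cells_def)
    next
      fix e assume "e \<in> cell_gen ` {C \<in> cells d P. card C = l + CARD('n)}"
      then obtain C where C: "e = cell_gen C" "C \<subseteq> box d" "full C" "corner C \<in> P" "card C = l + CARD('n)"
        by (auto simp: cells_def)
      have "(\<lambda>i. Max (C `` {i})) \<in> P" using C(4) by (simp add: corner_def[abs_def])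
      moreover have "C `` {i} \<noteq> {} \<and> C `` {i} \<subseteq> {1..d i}" for i
        using C(2,3) by (auto simp: full_def box_def)
      moreover have "(\<Sum>i\<in>UNIV. card (C `` {i})) = l + CARD('n)"
        using card_fibres[OF finite_subset_box[OF C(2)]] C(5) by simp
      ultimately show "e \<in> {Kos A |A. (\<forall>i. A i \<noteq> {} \<and> A i \<subseteq> {1..d i}) \<and> (\<lambda>i. Max (A i)) \<in> P \<and>
        (\<Sum>i\<in>UNIV. card (A i)) = l + CARD('n)}"
        unfolding C(1) cell_gen_def by blast
    qed
    then show ?thesis by (simp add: K_tilde_def gens_cell_complex Suc)
  qed
  ultimately show ?thesis
    by (simp add: base_change_def cell_complex_def fun_eq_iff)
qed

section \<open>Linearly independent linear forms are a regular sequence\<close>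

lemma lookup_single_mult:
  "Poly_Mapping.lookup (Poly_Mapping.single s c * h) n =
    (\<Sum>m\<in>Poly_Mapping.keys h. if s + m = n then c * Poly_Mapping.lookup h m else 0)"
proof -
  have "Poly_Mapping.single s c * h =
      Poly_Mapping.single s c * (\<Sum>m\<in>Poly_Mapping.keys h. Poly_Mapping.single m (Poly_Mapping.lookup h m))"
    by (simp flip: poly_mapping_eq_sum_single)
  then show ?thesis by (simp add: sum_distrib_left mult_single lookup_sum lookup_single when_def)
qed

text \<open>If the variable \<open>b0\<close> occurs in the linear form, choose a monomial \<open>m0\<close> of \<open>h\<close> with the largest exponent of \<open>b0\<close>: the monomial
  \<open>b0 m0\<close> of the product arises in no other way.\<close>

lemma linear_form_nonzerodivisor:
  fixes h :: "('b::finite, 'k::field) mpoly"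
  assumes zero: "(\<Sum>b\<in>UNIV. const (r b) * var b) * h = 0" and r: "r b0 \<noteq> 0"
  shows "h = 0"
proof (rule ccontr)
  assume "h \<noteq> 0"
  then have "Poly_Mapping.keys h \<noteq> {}" by simp
  then have "Max ((\<lambda>m. Poly_Mapping.lookup m b0) ` Poly_Mapping.keys h) \<in>
      (\<lambda>m. Poly_Mapping.lookup m b0) ` Poly_Mapping.keys h"
    by (intro Max_in) simp_all
  then obtain m0 where m0: "m0 \<in> Poly_Mapping.keys h"
    and m0_Max: "Poly_Mapping.lookup m0 b0 = Max ((\<lambda>m. Poly_Mapping.lookup m b0) ` Poly_Mapping.keys h)"
    by auto
  have max: "Poly_Mapping.lookup m b0 \<le> Poly_Mapping.lookup m0 b0" if "m \<in> Poly_Mapping.keys h" for m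
    unfolding m0_Max using that by (intro Max_ge) simp_all
  let ?n = "Poly_Mapping.single b0 1 + m0"
  have "Poly_Mapping.lookup (const (r b) * var b * h) ?n =
      (if b = b0 then r b0 * Poly_Mapping.lookup h m0 else 0)" for b
  proof (cases "b = b0")
    case True
    then show ?thesis
      using m0 by (simp add: const_def var_def mult_single lookup_single_mult)
  next
    case False
    have "Poly_Mapping.single b (1 :: nat) + m \<noteq> ?n" if "m \<in> Poly_Mapping.keys h" for m
    proof
      assume "Poly_Mapping.single b (1 :: nat) + m = ?n"
      then have "Poly_Mapping.lookup (Poly_Mapping.single b (1 :: nat) + m) b0 = Poly_Mapping.lookup ?n b0"
        by simp
      then show False using False max[OF that] by (simp add: lookup_add lookup_single)
    qed
    then show ?thesis
      using False by (simp add: const_def var_def mult_single lookup_single_mult)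
  qed
  then have "Poly_Mapping.lookup ((\<Sum>b\<in>UNIV. const (r b) * var b) * h) ?n = r b0 * Poly_Mapping.lookup h m0"
    by (simp add: sum_distrib_right lookup_sum)
  then show False using zero r m0 by (simp add: in_keys_iff)
qed

text \<open>A vector space with a basis indexed by the variables of the polynomial ring; \<open>lf\<close> embeds it as the space of linear forms.\<close>

locale coordinate_space =
  finite_dimensional_vector_space scale "range x"
  for scale :: "'k::field \<Rightarrow> 'v::ab_group_add \<Rightarrow> 'v" and x :: "'b::finite \<Rightarrow> 'v" +
  assumes inj_x: "inj x"
begin

abbreviation lf :: "'v \<Rightarrow> ('b, 'k) mpoly" where
  "lf \<equiv> lin_form scale x"

lemma in_span_basis: "v \<in> span (range x)"
  by (simp add: span_Basis)

lemma lin_form_add: "lf (u + v) = lf u + lf v"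
  by (simp add: lin_form_def representation_add[OF independent_Basis in_span_basis in_span_basis]
      const_add distrib_right sum.distrib)

lemma lin_form_scale: "lf (scale c v) = const c * lf v"
  by (simp add: lin_form_def representation_scale[OF independent_Basis in_span_basis]
      const_mult sum_distrib_left mult.assoc)

lemma lin_form_0: "lf 0 = 0"
  using lin_form_scale[of 0 0] by (simp add: const_0)

lemma lin_form_diff: "lf (u - v) = lf u - lf v"
  using lin_form_add[of "u - v" v] by simp

lemma lin_form_sum: "lf (sum u A) = (\<Sum>a\<in>A. lf (u a))"
  by (induction A rule: infinite_finite_induct) (simp_all add: lin_form_0 lin_form_add)

lemma lin_form_basis: "lf (x b) = var b"
proof -
  have "const (if b' = b then 1 else 0) * var b' = (if b' = b then var b else (0 :: ('b, 'k) mpoly))" for b'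
    by (simp add: const_0 const_1)
  then show ?thesis
    by (simp add: lin_form_def representation_basis[OF independent_Basis] inj_eq[OF inj_x])
qed

lemma sum_coordinates: "(\<Sum>b\<in>UNIV. scale (representation (range x) v (x b)) (x b)) = v"
proof -
  have "(\<Sum>b\<in>range x. scale (representation (range x) v b) b) = v"
    by (rule sum_representation_eq[OF independent_Basis in_span_basis]) simp_all
  then show ?thesis by (simp add: sum.reindex[OF inj_x])
qed

lemma lin_form_nonzerodivisor:
  assumes "v \<noteq> 0" "lf v * h = 0"
  shows "h = 0"
proof -
  have "\<exists>b. representation (range x) v (x b) \<noteq> 0"
  proof (rule ccontr)
    assume "\<not> ?thesis"
    then show False using sum_coordinates[of v] assms(1) by simp
  qed
  then obtain b where "representation (range x) v (x b) \<noteq> 0" by blast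
  with assms(2)[unfolded lin_form_def] show ?thesis
    by (rule linear_form_nonzerodivisor[where r="\<lambda>b. representation (range x) v (x b)"])
qed

lemma lin_form_homogeneous: "homogeneous 1 (lf v)"
  unfolding lin_form_def
  using homogeneous_mult[OF homogeneous_const homogeneous_var] by (intro homogeneous_sum) simp

lemma lin_form_span:
  assumes "finite I" "v \<in> span (F ` I)"
  shows "lf v \<in> lin_combs (\<lambda>q. lf (F q)) I"
  using assms(2)
proof (induction rule: span_induct_alt)
  case base
  then show ?case by (simp add: lin_form_0 lin_combs_0)
next
  case (step c u v)
  then obtain q where "q \<in> I" "u = F q" by blast
  then have "lf (F q) * const c \<in> lin_combs (\<lambda>q. lf (F q)) I"
    using lin_combs_generator[OF assms(1), of q "\<lambda>q. lf (F q)"] by (intro lin_combs_mult)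
  then show ?case
    using step \<open>u = F q\<close> by (simp add: lin_form_add lin_form_scale lin_combs_add mult.commute)
qed

text \<open>Extend \<open>insert w S\<close> to a basis and send the elements of \<open>S\<close> to 0 and all other basis vectors to themselves.\<close>

lemma projection_along:
  assumes "independent (insert w S)" "w \<notin> S"
  shows "\<exists>\<pi>. Vector_Spaces.linear scale scale \<pi> \<and> \<pi> w = w \<and> (\<forall>s\<in>S. \<pi> s = 0) \<and>
    (\<forall>v. v - \<pi> v \<in> span S)"
proof -
  interpret vp: vector_space_pair scale scale by unfold_locales
  obtain B where B: "insert w S \<subseteq> B" "independent B" "UNIV \<subseteq> span B"
    by (rule maximal_independent_subset_extend[OF subset_UNIV assms(1)])
  obtain \<pi> where lin: "Vector_Spaces.linear scale scale \<pi>"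
    and \<pi>: "\<And>b. b \<in> B \<Longrightarrow> \<pi> b = (if b \<in> S then 0 else b)"
    using vp.linear_independent_extend[OF B(2), of "\<lambda>b. if b \<in> S then 0 else b"] by blast
  have "v - \<pi> v \<in> span S" for v
  proof -
    have "v \<in> span B" using B(3) by blast
    then show ?thesis
    proof (induction rule: span_induct_alt)
      case base
      then show ?case by (simp add: vp.linear_0[OF lin] span_zero)
    next
      case (step c b v)
      have "b - \<pi> b \<in> span S" using \<pi>[OF step(1)] by (simp add: span_zero span_base)
      then have "scale c (b - \<pi> b) + (v - \<pi> v) \<in> span S"
        using step by (intro span_add span_scale)
      then show ?case
        by (simp add: vp.linear_add[OF lin] vp.linear_scale[OF lin] scale_right_diff_distrib algebra_simps)
    qed
  qed
  moreover have "\<pi> w = w" using \<pi> B(1) assms(2) by simp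
  moreover have "\<pi> s = 0" if "s \<in> S" for s using \<pi> B(1) that by auto
  ultimately show ?thesis using lin by blast
qed

text \<open>The substitution \<open>\<phi>\<close> induced by the projection \<open>\<pi>\<close> kills the ideal of the forms \<open>lf (F q)\<close>, and it is the identity modulo
  that ideal since it is so on variables. Hence the ideal is the kernel of \<open>\<phi>\<close>, and as \<open>\<phi>\<close> fixes
  \<open>lf (F p)\<close>, the claim reduces to the injectivity of multiplication by a nonzero linear form.\<close>

theorem nzd_mod_lin_form:
  assumes "finite I" "p \<notin> I" "inj_on F (insert p I)" "independent (F ` insert p I)"
  shows "nzd_mod (\<lambda>q. lf (F q)) I (lf (F p))"
proof -
  interpret vp: vector_space_pair scale scale by unfold_locales
  let ?L = "lin_combs (\<lambda>q. lf (F q)) I"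
  have notin: "F p \<notin> F ` I" using assms(2,3) by (auto simp: inj_on_def)
  have indep: "independent (insert (F p) (F ` I))" using assms(4) by simp
  obtain \<pi> where lin: "Vector_Spaces.linear scale scale \<pi>" and \<pi>_p: "\<pi> (F p) = F p"
    and \<pi>_I: "\<And>s. s \<in> F ` I \<Longrightarrow> \<pi> s = 0" and \<pi>_span: "\<And>v. v - \<pi> v \<in> span (F ` I)"
    using projection_along[OF indep notin] by blast
  define \<phi> where "\<phi> = subst_hom (\<lambda>b. lf (\<pi> (x b)))"
  have \<phi>_lf: "\<phi> (lf v) = lf (\<pi> v)" for v
  proof -
    let ?r = "\<lambda>b. representation (range x) v (x b)"
    have "\<phi> (lf v) = (\<Sum>b\<in>UNIV. const (?r b) * lf (\<pi> (x b)))"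
      by (simp add: \<phi>_def lin_form_def[of _ _ v] subst_hom_sum subst_hom_mult subst_hom_const subst_hom_var)
    also have "\<dots> = lf (\<pi> (\<Sum>b\<in>UNIV. scale (?r b) (x b)))"
      by (simp add: vp.linear_sum[OF lin] vp.linear_scale[OF lin] lin_form_sum lin_form_scale)
    finally show ?thesis by (simp add: sum_coordinates)
  qed
  have \<phi>_mod: "g - \<phi> g \<in> ?L" for g
  proof (induction g rule: mpoly_induct)
    case (const c)
    then show ?case by (simp add: \<phi>_def subst_hom_const lin_combs_0)
  next
    case (var b)
    have "var b - \<phi> (var b) = lf (x b - \<pi> (x b))"
      by (simp add: \<phi>_def subst_hom_var lin_form_diff lin_form_basis)
    then show ?case using lin_form_span[OF assms(1) \<pi>_span] by simp
  next
    case (add g h)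
    have "g + h - \<phi> (g + h) = (g - \<phi> g) + (h - \<phi> h)" by (simp add: \<phi>_def subst_hom_add)
    then show ?case using add lin_combs_add by metis
  next
    case (mult g h)
    have "g * h - \<phi> (g * h) = (g - \<phi> g) * h + (h - \<phi> h) * \<phi> g"
      by (simp add: \<phi>_def subst_hom_mult algebra_simps)
    then show ?case using mult lin_combs_add lin_combs_mult by metis
  qed
  have \<phi>_L: "\<phi> g = 0" if L: "g \<in> ?L" for g
  proof -
    obtain c where "g = (\<Sum>q\<in>I. lf (F q) * c q)" using L by (rule lin_combsE)
    then have "\<phi> g = (\<Sum>q\<in>I. \<phi> (lf (F q)) * \<phi> (c q))"
      by (simp add: \<phi>_def subst_hom_sum subst_hom_mult)
    then show ?thesis by (simp add: \<phi>_lf \<pi>_I lin_form_0)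
  qed
  show ?thesis
    unfolding nzd_mod_def
  proof (intro allI impI)
    fix g assume "g * lf (F p) \<in> ?L"
    then have "\<phi> (g * lf (F p)) = 0" by (rule \<phi>_L)
    then have "lf (F p) * \<phi> g = 0"
      using \<phi>_lf[of "F p"] \<pi>_p by (simp add: \<phi>_def subst_hom_mult mult.commute)
    moreover have "F p \<noteq> 0" using assms(4) dependent_zero by fastforce
    ultimately have "\<phi> g = 0" by (rule lin_form_nonzerodivisor[rotated])
    then show "g \<in> ?L" using \<phi>_mod[of g] by simp
  qed
qed

end

section \<open>Rado's theorem and generic bases\<close>

context finite_dimensional_vector_space
begin

lemma dim_submodular: "dim (A \<union> B) + dim (span A \<inter> span B) \<le> dim A + dim B"
proof -
  let ?S = "{a + b |a b. a \<in> span A \<and> b \<in> span B}"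
  have "dim (A \<union> B) \<le> dim ?S"
  proof (rule dim_subset)
    show "A \<union> B \<subseteq> ?S"
    proof
      fix v assume "v \<in> A \<union> B"
      moreover have "v = v + 0" "v = 0 + v" by simp_all
      ultimately show "v \<in> ?S" using span_base span_zero by blast
    qed
  qed
  then show ?thesis using dim_sums_Int[of "span A" "span B"] by simp
qed

text \<open>Rado's theorem on independent transversals, for finite sets of vectors. If a set \<open>A j\<close> has two
  different elements, one of them can be removed without losing the rank condition: otherwise two index sets \<open>T\<close> and \<open>T'\<close> violate it after
  the respective removal, and submodularity of the dimension gives a violation by \<open>T \<union> T' \<union> {j}\<close> or
  \<open>T \<inter> T'\<close> before it. When no set has two elements, the rank condition makes all of them
  singletons, and for the whole index set it says that these are independent.\<close>

theorem rado:
  fixes A :: "'j \<Rightarrow> 'b set"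
  assumes "finite J" "\<And>j. j \<in> J \<Longrightarrow> finite (A j)"
    and "\<And>T. T \<subseteq> J \<Longrightarrow> card T \<le> dim (\<Union>j\<in>T. A j)"
  shows "\<exists>v. (\<forall>j\<in>J. v j \<in> A j) \<and> inj_on v J \<and> independent (v ` J)"
  using assms(2,3)
proof (induction "\<Sum>j\<in>J. card (A j)" arbitrary: A rule: less_induct)
  case less
  note finA = less.prems(1) and rank = less.prems(2)
  show ?case
  proof (cases "\<exists>j\<in>J. \<exists>x\<in>A j. \<exists>x'\<in>A j. x \<noteq> x'")
    case False
    have "\<exists>v. v \<in> A j" if "j \<in> J" for j
    proof (rule ccontr)
      assume "\<not> ?thesis"
      then have "A j \<subseteq> {0}" by blast
      then have "dim (A j) = 0" by (simp only: dim_eq_0)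
      moreover have "1 \<le> dim (A j)" using rank[of "{j}"] that by simp
      ultimately show False by linarith
    qed
    then obtain v where v: "\<And>j. j \<in> J \<Longrightarrow> v j \<in> A j" by metis
    then have "(\<Union>j\<in>J. A j) = v ` J" using False by blast
    then have "card J \<le> dim (v ` J)" using rank[of J] by simp
    moreover have "dim (v ` J) \<le> card (v ` J)" using assms(1) by (intro dim_le_card span_superset) simp
    moreover have "card (v ` J) \<le> card J" using assms(1) by (rule card_image_le)
    ultimately have "card (v ` J) = card J" "dim (v ` J) = card (v ` J)" by simp_all
    then have "inj_on v J" "independent (v ` J)"
      using assms(1) card_le_dim_spanning[of "v ` J" "v ` J"] by (auto simp: eq_card_imp_inj_on span_superset)
    then show ?thesis using v by blast
  next
    case True
    then obtain j x x' where j: "j \<in> J" "x \<in> A j" "x' \<in> A j" "x \<noteq> x'" by blast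
    have shrink: "\<exists>T\<subseteq>J - {j}. dim ((\<Union>i\<in>T. A i) \<union> (A j - {u})) \<le> card T"
      if none: "\<not> (\<exists>v. (\<forall>j\<in>J. v j \<in> A j) \<and> inj_on v J \<and> independent (v ` J))" and u: "u \<in> A j" for u
    proof -
      define A' where "A' = A(j := A j - {u})"
      have "(\<Sum>i\<in>J. card (A' i)) < (\<Sum>i\<in>J. card (A i))"
      proof (rule sum_strict_mono_ex1[OF assms(1)])
        show "\<forall>i\<in>J. card (A' i) \<le> card (A i)" using finA by (auto simp: A'_def card_mono)
        show "\<exists>i\<in>J. card (A' i) < card (A i)"
          using j(1) card_Diff1_less[OF finA[OF j(1)] u]
          by (intro bexI[of _ j]) (simp_all only: A'_def fun_upd_same)
      qed
      moreover have "\<not> (\<exists>v. (\<forall>j\<in>J. v j \<in> A' j) \<and> inj_on v J \<and> independent (v ` J))"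
        using none by (auto simp: A'_def split: if_splits)
      moreover have "finite (A' i)" if "i \<in> J" for i using finA that by (auto simp: A'_def)
      ultimately obtain T where T: "T \<subseteq> J" "\<not> card T \<le> dim (\<Union>i\<in>T. A' i)"
        using less.hyps[of A'] by blast
      have "j \<in> T"
      proof (rule ccontr)
        assume "j \<notin> T"
        then have "(\<Union>i\<in>T. A' i) = (\<Union>i\<in>T. A i)" by (auto simp: A'_def)
        then show False using T rank[of T] by simp
      qed
      have "(\<Union>i\<in>T. A' i) = (\<Union>i\<in>T - {j}. A i) \<union> (A j - {u})"
        using \<open>j \<in> T\<close> by (auto simp: A'_def split: if_splits)
      moreover have "card T = Suc (card (T - {j}))"
        using T(1) assms(1) \<open>j \<in> T\<close> finite_subset by (metis card_Suc_Diff1)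
      ultimately show ?thesis using T by (intro exI[of _ "T - {j}"]) auto
    qed
    show ?thesis
    proof (rule ccontr)
      assume none: "\<not> ?thesis"
      obtain T where T: "T \<subseteq> J - {j}" "dim ((\<Union>i\<in>T. A i) \<union> (A j - {x})) \<le> card T"
        using shrink[OF none j(2)] by blast
      obtain T' where T': "T' \<subseteq> J - {j}" "dim ((\<Union>i\<in>T'. A i) \<union> (A j - {x'})) \<le> card T'"
        using shrink[OF none j(3)] by blast
      let ?U = "(\<Union>i\<in>T. A i) \<union> (A j - {x})" and ?U' = "(\<Union>i\<in>T'. A i) \<union> (A j - {x'})"
      have fin: "finite T" "finite T'" using T(1) T'(1) assms(1) finite_subset by blast+
      have "(\<Union>i\<in>insert j (T \<union> T'). A i) = ?U \<union> ?U'" using j by blast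
      then have "card (insert j (T \<union> T')) \<le> dim (?U \<union> ?U')"
        using rank[of "insert j (T \<union> T')"] T(1) T'(1) j(1) by (metis Diff_subset Un_least insert_subset order_trans)
      moreover have "card (insert j (T \<union> T')) = Suc (card (T \<union> T'))"
        using T(1) T'(1) fin by (subst card_insert_disjoint) auto
      moreover have "card (T \<inter> T') \<le> dim (span ?U \<inter> span ?U')"
      proof -
        have "card (T \<inter> T') \<le> dim (\<Union>i\<in>T \<inter> T'. A i)" using T(1) by (intro rank) blast
        also have "\<dots> \<le> dim (span ?U \<inter> span ?U')" by (intro dim_subset) (auto intro: span_base)
        finally show ?thesis .
      qed
      moreover have "card T + card T' = card (T \<union> T') + card (T \<inter> T')"
        using fin by (rule card_Un_Int)
      ultimately show False using dim_submodular[of ?U ?U'] T(2) T'(2) by linarith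
    qed
  qed
qed

lemma independent_extend_ordered_basis:
  assumes "subspace U" "inj_on v {1..c}" "independent (v ` {1..c})" "v ` {1..c} \<subseteq> U"
  obtains h where "\<And>j. j \<in> {1..c} \<Longrightarrow> h j = v j" "inj_on h {1..dim U}"
    "independent (h ` {1..dim U})" "span (h ` {1..dim U}) = U"
proof -
  obtain B where B: "v ` {1..c} \<subseteq> B" "B \<subseteq> U" "independent B" "U \<subseteq> span B"
    by (rule maximal_independent_subset_extend[OF assms(4,3)])
  have finB: "finite B" and cardB: "card B = dim U"
    using B finiteI_independent basis_card_eq_dim by blast+
  have cB: "c \<le> dim U"
    using card_mono[OF finB B(1)] cardB card_image[OF assms(2)] by simp
  have "card {c<..dim U} = card (B - v ` {1..c})"
    using B(1) cardB card_image[OF assms(2)] by (simp add: card_Diff_subset)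
  then obtain t where t: "bij_betw t {c<..dim U} (B - v ` {1..c})"
    using finite_same_card_bij[of "{c<..dim U}" "B - v ` {1..c}"] finB by auto
  define h where "h = (\<lambda>j. if j \<in> {1..c} then v j else t j)"
  have "bij_betw h {1..c} (v ` {1..c})"
    using inj_on_imp_bij_betw[OF assms(2)] by (subst bij_betw_cong[of _ h v]) (simp_all add: h_def)
  moreover have "bij_betw h {c<..dim U} (B - v ` {1..c})"
    using t by (subst bij_betw_cong[of _ h t]) (simp_all add: h_def)
  ultimately have "bij_betw h ({1..c} \<union> {c<..dim U}) (v ` {1..c} \<union> (B - v ` {1..c}))"
    by (rule bij_betw_combine) auto
  moreover have "{1..c} \<union> {c<..dim U} = {1..dim U}" using cB by auto
  moreover have "v ` {1..c} \<union> (B - v ` {1..c}) = B" using B(1) by auto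
  ultimately have "bij_betw h {1..dim U} B" by simp
  moreover have "span B = U" using B(2,4) assms(1) span_minimal by blast
  ultimately show ?thesis using that[of h] B(3) by (auto simp: bij_betw_def h_def)
qed

text \<open>Rado's theorem, applied to \<open>c i\<close> copies of a basis of each \<open>V i\<close>, provides one collection of bases \<open>h\<close> for which
  the space \<open>W_space scale h c\<close> has the dimension \<open>\<Sum>i. c i\<close>; by genericity \<open>W_space scale f c\<close> has at least this dimension,
  and it is spanned by that many vectors.\<close>

theorem generic_bases_independent:
  fixes V :: "'n::finite \<Rightarrow> 'b set"
  assumes sub: "\<And>i. subspace (V i)" and generic: "generic_bases scale V f"
    and c_le: "\<And>i. c i \<le> dim (V i)"
    and rank: "\<And>T. (\<Sum>i\<in>T. c i) \<le> arr_rank scale V T"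
  defines "I \<equiv> SIGMA i:UNIV. {1..c i}"
  shows "inj_on (\<lambda>(i, j). f i j) I \<and> independent ((\<lambda>(i, j). f i j) ` I)"
proof -
  have finI: "finite I" by (simp add: I_def)
  have cardI: "card I = (\<Sum>i\<in>UNIV. c i)" by (simp add: I_def)
  have "\<exists>B. finite B \<and> B \<subseteq> V i \<and> span B = V i" for i
    using basis_exists[of "V i"] sub[of i] finiteI_independent span_minimal
    by (metis subset_antisym)
  then obtain B where B: "\<And>i. finite (B i)" "\<And>i. B i \<subseteq> V i" "\<And>i. span (B i) = V i" by metis
  have "\<exists>v. (\<forall>p\<in>I. v p \<in> B (fst p)) \<and> inj_on v I \<and> independent (v ` I)"
  proof (rule rado[OF finI])
    fix T assume T: "T \<subseteq> I"
    then have "card T \<le> card (SIGMA i:fst ` T. {1..c i})"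
      by (intro card_mono) (force simp: I_def finite_subset[OF T finI])+
    also have "\<dots> = (\<Sum>i\<in>fst ` T. c i)" using finite_subset[OF T finI] by simp
    also have "\<dots> \<le> dim (span (\<Union>i\<in>fst ` T. V i))"
      using rank[of "fst ` T"] by (simp add: arr_rank_def)
    also have "\<dots> \<le> dim (span (\<Union>p\<in>T. B (fst p)))"
    proof (intro dim_subset span_minimal subspace_span UN_least)
      fix i assume "i \<in> fst ` T"
      then have "span (B i) \<subseteq> span (\<Union>p\<in>T. B (fst p))" by (intro span_mono) auto
      then show "V i \<subseteq> span (\<Union>p\<in>T. B (fst p))" using B(3) by simp
    qed
    finally show "card T \<le> dim (\<Union>p\<in>T. B (fst p))" by simp
  qed (simp add: B(1))
  then obtain v where v: "\<And>p. p \<in> I \<Longrightarrow> v p \<in> B (fst p)" "inj_on v I" "independent (v ` I)" by blast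
  have "\<exists>h. (\<forall>j\<in>{1..c i}. h j = v (i, j)) \<and> inj_on h {1..dim (V i)} \<and>
      independent (h ` {1..dim (V i)}) \<and> span (h ` {1..dim (V i)}) = V i" for i
  proof (rule independent_extend_ordered_basis[OF sub[of i], of "\<lambda>j. v (i, j)" "c i"])
    show "inj_on (\<lambda>j. v (i, j)) {1..c i}" using v(2) by (auto simp: inj_on_def I_def)
    have "(\<lambda>j. v (i, j)) ` {1..c i} \<subseteq> v ` I" by (auto simp: I_def)
    then show "independent ((\<lambda>j. v (i, j)) ` {1..c i})" using v(3) independent_mono by blast
    show "(\<lambda>j. v (i, j)) ` {1..c i} \<subseteq> V i" using v(1)[of "(i, _)"] B(2)[of i] by (auto simp: I_def)
  qed blast
  then obtain h where h: "\<And>i j. j \<in> {1..c i} \<Longrightarrow> h i j = v (i, j)" "\<And>i. inj_on (h i) {1..dim (V i)}"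
    "\<And>i. independent (h i ` {1..dim (V i)})" "\<And>i. span (h i ` {1..dim (V i)}) = V i" by metis
  have "bases_collection scale V h" using h(2-4) by (simp add: bases_collection_def)
  then have le: "dim (W_space scale h c) \<le> dim (W_space scale f c)"
    using generic c_le by (simp add: generic_bases_def)
  have "{h i j |i j. j \<in> {1..c i}} = v ` I" using h(1) by (force simp: I_def image_iff)
  then have "dim (W_space scale h c) = card I"
    using v(2,3) by (simp add: W_space_def dim_eq_card_independent card_image)
  moreover have "{f i j |i j. j \<in> {1..c i}} = (\<lambda>(i, j). f i j) ` I" by (force simp: I_def image_iff)
  ultimately have "card I \<le> dim ((\<lambda>(i, j). f i j) ` I)" using le by (simp add: W_space_def)
  moreover have "dim ((\<lambda>(i, j). f i j) ` I) \<le> card ((\<lambda>(i, j). f i j) ` I)"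
    using finI by (intro dim_le_card span_superset) simp
  moreover have "card ((\<lambda>(i, j). f i j) ` I) \<le> card I" using finI by (rule card_image_le)
  ultimately have "card ((\<lambda>(i, j). f i j) ` I) = card I"
    "dim ((\<lambda>(i, j). f i j) ` I) = card ((\<lambda>(i, j). f i j) ` I)" by linarith+
  then show ?thesis
    using finI card_le_dim_spanning[of "(\<lambda>(i, j). f i j) ` I" "(\<lambda>(i, j). f i j) ` I"]
    by (simp add: eq_card_imp_inj_on span_superset)
qed

end

section \<open>The resolution\<close>

text \<open>The internal degree: the map from homological degree 1 to the ring has entries of degree \<open>n\<close>, and all other
  differentials are linear.\<close>

fun gen_degree :: "'n::finite gen \<Rightarrow> nat" where
  "gen_degree Aug = 0"
| "gen_degree (Kos A) = (\<Sum>i\<in>UNIV. card (A i))"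

lemma cell_bd_homogeneous:
  fixes d :: "'n::{finite,linorder} \<Rightarrow> nat" and y :: "'n \<times> nat \<Rightarrow> ('b, 'k::comm_ring_1) mpoly"
  assumes y: "\<And>p. homogeneous 1 (y p)"
    and e: "e \<in> gens (cell_complex d P y) (Suc k)" and e': "e' \<in> Poly_Mapping.keys (cell_bd y e)"
  shows "gen_degree e' < gen_degree e \<and>
    homogeneous (gen_degree e - gen_degree e') (Poly_Mapping.lookup (cell_bd y e) e')"
proof -
  obtain C where C: "e = cell_gen C" "C \<subseteq> box d" "full C"
    using e by (auto simp: gens_cell_complex cells_def)
  have fin: "finite C" using C(2) finite_subset_box by blast
  have deg: "gen_degree (cell_gen D) = card D" if "finite D" for D :: "('n \<times> nat) set"
    using card_fibres[OF that] by (simp add: cell_gen_def)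
  show ?thesis
  proof (cases "card C = CARD('n)")
    case True
    then have "C = graph (corner C)" by (rule full_card_graph[OF C(2,3)])
    then have bd: "cell_bd y e = Poly_Mapping.single Aug (\<Prod>i\<in>UNIV. y (i, corner C i))"
      using cell_bd_graph[of y "corner C"] C(1) by simp
    then have "e' = Aug" using e' by (auto split: if_splits)
    moreover have "homogeneous CARD('n) (\<Prod>i\<in>UNIV. y (i, corner C i))"
      by (intro homogeneous_prod y)
    ultimately show ?thesis unfolding bd using deg[OF fin] True C(1) by simp
  next
    case False
    let ?t = "\<lambda>p. (-1) ^ card {c \<in> C - {p}. c < p} * twist y p"
    have lookup: "Poly_Mapping.lookup (cell_bd y e) e' =
        (\<Sum>p\<in>{p \<in> C. full (C - {p})}. if cell_gen (C - {p}) = e' then ?t p else 0)"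
      by (simp only: C(1) cell_bd_eq[OF C(2,3) False] lookup_sum lookup_single when_def)
    have "homogeneous 1 (?t p)" for p
      unfolding twist_def by (intro homogeneous_neg_one_power_mult y)
    then have "homogeneous 1 (if cell_gen (C - {p}) = e' then ?t p else 0)" for p
      by (cases "cell_gen (C - {p}) = e'") (simp_all only: simp_thms if_True if_False homogeneous_0)
    then have hom: "homogeneous 1 (Poly_Mapping.lookup (cell_bd y e) e')"
      unfolding lookup by (intro homogeneous_sum)
    have "\<exists>p\<in>C. cell_gen (C - {p}) = e'"
    proof (rule ccontr)
      assume "\<not> ?thesis"
      then have "Poly_Mapping.lookup (cell_bd y e) e' = 0" unfolding lookup by (intro sum.neutral) auto
      then show False using e' by (simp add: in_keys_iff)
    qed
    then obtain p where p: "p \<in> C" "e' = cell_gen (C - {p})" by blast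
    then have "gen_degree e = Suc (gen_degree e')"
      using deg[OF fin] deg[of "C - {p}"] fin card_Suc_Diff1[OF fin p(1)] C(1) by simp
    then show ?thesis using hom by simp
  qed
qed

text \<open>All entries of the differentials are homogeneous of positive degree, as the internal degree drops strictly; this is
  minimality.\<close>

theorem minimal_free_resolution_cell_complex:
  fixes d :: "'n::{finite,linorder} \<Rightarrow> nat" and y :: "'n \<times> nat \<Rightarrow> ('b, 'k::comm_ring_1) mpoly"
  assumes "poset_ideal d P"
    and "\<And>a J p. a \<in> P \<Longrightarrow> J \<subseteq> below a \<Longrightarrow> p \<in> below a - J \<Longrightarrow> nzd_mod y J (y p)"
    and "\<And>a i. a \<in> P \<Longrightarrow> nzd_mod y (below a) (y (i, a i))"
    and y: "\<And>p. homogeneous 1 (y p)"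
  shows "minimal_free_resolution_of_quotient (cell_complex d P y)
    (ideal_gen ((\<lambda>a. \<Prod>i\<in>UNIV. y (i, a i)) ` P))"
proof -
  let ?F = "cell_complex d P y" and ?J = "ideal_gen ((\<lambda>a. \<Prod>i\<in>UNIV. y (i, a i)) ` P)"
  let ?\<epsilon> = "\<lambda>v. Poly_Mapping.lookup v Aug +o ?J"
  have "free_resolution ?F ?J ?\<epsilon>"
    by (rule free_resolution_cell_complex[OF assms(1-3)])
  moreover have "graded_with ?F ?J ?\<epsilon> gen_degree"
    unfolding graded_with_def bd_cell_complex
  proof (intro conjI allI ballI)
    fix k e e' assume "e \<in> gens ?F (Suc k)" "e' \<in> Poly_Mapping.keys (cell_bd y e)"
    from cell_bd_homogeneous[OF y this]
    show "gen_degree e' \<le> gen_degree e"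
      "homogeneous (gen_degree e - gen_degree e') (Poly_Mapping.lookup (cell_bd y e) e')" by simp_all
  next
    fix e assume "e \<in> gens ?F 0"
    then show "\<exists>p. homogeneous (gen_degree e) p \<and> ?\<epsilon> (Poly_Mapping.single e 1) = p +o ?J"
      by (intro exI[of _ 1]) (simp add: gens_cell_complex homogeneous_1)
  qed
  moreover have "minimal_complex ?F"
    unfolding minimal_complex_def bd_cell_complex
  proof (intro allI ballI)
    fix k e e' assume e: "e \<in> gens ?F (Suc k)"
    show "Poly_Mapping.lookup (cell_bd y e) e' \<in> irrelevant_ideal"
    proof (cases "e' \<in> Poly_Mapping.keys (cell_bd y e)")
      case True
      from cell_bd_homogeneous[OF y e this] show ?thesis
        by (auto intro: homogeneous_irrelevant)
    qed (simp add: in_keys_iff irrelevant_ideal_def)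
  qed
  ultimately show ?thesis unfolding minimal_free_resolution_of_quotient_def by blast
qed

context coordinate_space
begin

text \<open>The inequalities of \<open>D_arr\<close> for \<open>a\<close> bound the sums of \<open>a k - 1\<close> over \<open>T\<close> by \<open>rk T - 1\<close>; the
  slack of 1 allows for the additional vector \<open>f i (a i)\<close>.\<close>

lemma generic_bases_independent_below:
  fixes V :: "'n::finite \<Rightarrow> 'v set"
  assumes "\<And>i. subspace (V i)" "generic_bases scale V f" "a \<in> D_arr scale V"
  shows "inj_on (\<lambda>(i, j). f i j) (insert (i, a i) (below a)) \<and>
    independent ((\<lambda>(i, j). f i j) ` insert (i, a i) (below a))"
proof -
  \<comment> \<open>\<open>{1..?c k}\<close> lists the points of \<open>below a\<close> in row \<open>k\<close>, and for \<open>k = i\<close> also \<open>a i\<close>.\<close>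
  let ?c = "\<lambda>k. if k = i then a k else a k - 1"
  have a: "1 \<le> a k" "a k \<le> dim (V k)" for k
    using assms(3) by (auto simp: D_arr_def D_box_def)
  have c_le: "?c k \<le> dim (V k)" for k using a(2)[of k] by auto
  have rank: "(\<Sum>k\<in>T. ?c k) \<le> arr_rank scale V T" for T
  proof (cases "T = {}")
    case False
    have "int (?c k) = int (a k) - 1 + (if k = i then 1 else 0)" for k using a(1)[of k] by auto
    then have "int (\<Sum>k\<in>T. ?c k) = (\<Sum>k\<in>T. int (a k)) - int (card T) + (if i \<in> T then 1 else 0)"
      by (simp add: sum.distrib sum_subtractf)
    also have "\<dots> \<le> int (arr_rank scale V T)"
      using assms(3) False by (auto simp: D_arr_def)
    finally show ?thesis by (simp only: of_nat_le_iff)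
  qed simp
  have "(SIGMA k:UNIV. {1..?c k}) = insert (i, a i) (below a)"
  proof (intro set_eqI iffI)
    fix p assume "p \<in> insert (i, a i) (below a)"
    then show "p \<in> (SIGMA k:UNIV. {1..?c k})" using a(1)[of i] by (auto simp: below_def)
  qed (auto simp: below_def split: if_splits)
  then show ?thesis
    using generic_bases_independent[OF assms(1,2) c_le rank] by simp
qed

end

theorem theorem4p6:
  fixes scale :: "'k::field \<Rightarrow> 'v::ab_group_add \<Rightarrow> 'v"
    and x :: "'b::finite \<Rightarrow> 'v"
    and V :: "'n::{finite,linorder} \<Rightarrow> 'v set"
    and f :: "'n \<Rightarrow> nat \<Rightarrow> 'v"
    and P :: "('n \<Rightarrow> nat) set"
  assumes "infinite (UNIV :: 'k set)"
    and "finite_dimensional_vector_space scale (range x)" and "inj x"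
    and "subspace_arrangement scale V"
    and "generic_bases scale V f"
    and "poset_ideal (\<lambda>i. vector_space.dim scale (V i)) P"
    and "P \<subseteq> D_arr scale V"
  shows "minimal_free_resolution_of_quotient
           (base_change (subst_hom (\<lambda>(i, j). lin_form scale x (f i j)))
              (K_tilde (\<lambda>i. vector_space.dim scale (V i)) P))
           (J_ideal (\<lambda>i j. lin_form scale x (f i j)) P)"
proof -
  interpret coordinate_space scale x
    using assms(2,3) by (simp add: coordinate_space_def coordinate_space_axioms_def)
  let ?f = "\<lambda>(i, j). f i j" and ?y = "\<lambda>(i, j). lf (f i j)"
  have y: "?y = (\<lambda>p. lf (?f p))" by (simp add: fun_eq_iff)
  have sub: "\<And>i. subspace (V i)" using assms(4) by (simp add: subspace_arrangement_def)
  have indep: "inj_on ?f (insert (i, a i) (below a))" "independent (?f ` insert (i, a i) (below a))"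
    if "a \<in> P" for a i
    using generic_bases_independent_below[OF sub assms(5)] assms(7) that by blast+
  have "minimal_free_resolution_of_quotient (cell_complex (\<lambda>i. dim (V i)) P ?y)
    (ideal_gen ((\<lambda>a. \<Prod>i\<in>UNIV. ?y (i, a i)) ` P))"
    unfolding y
  proof (rule minimal_free_resolution_cell_complex[OF assms(6)])
    fix a J p assume a: "a \<in> P" and J: "J \<subseteq> below a" "p \<in> below a - J"
    have sub: "insert p J \<subseteq> insert (i, a i) (below a)" for i using J by blast
    show "nzd_mod (\<lambda>p. lf (?f p)) J (lf (?f p))"
    proof (rule nzd_mod_lin_form)
      show "finite J" using J(1) finite_below finite_subset by blast
      show "p \<notin> J" using J(2) by blast
      show "inj_on ?f (insert p J)" by (rule inj_on_subset[OF indep(1)[OF a] sub])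
      show "independent (?f ` insert p J)" by (rule independent_mono[OF indep(2)[OF a] image_mono[OF sub]])
    qed
  next
    fix a i assume a: "a \<in> P"
    show "nzd_mod (\<lambda>p. lf (?f p)) (below a) (lf (?f (i, a i)))"
      by (rule nzd_mod_lin_form[OF finite_below _ indep[OF a]]) (simp add: below_def)
  qed (rule lin_form_homogeneous)
  then show ?thesis
    by (simp add: base_change_K_tilde J_ideal_def)
qed

end
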